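(* Let $n\ge 2$, let $\Omega\subseteq\mathbb{R}^n$ be a convex domain, let $\nu$ be an admissible measure on the space $\mathcal{H}$ of hyperplanes, and let $d_\nu$ be the associated Busemann-type projective metric on $\Omega$. Suppose that there exists a modulus of quasisymmetry $\eta$ such that the identity map $\mathrm{id}\colon(\Omega,d_\nu)\to(\Omega,d_e)$ is locally $\eta$-quasisymmetric, where $d_e$ is the Euclidean metric. Then $(\Omega,d_\nu)$ is bi-Lipschitz equivalent to $(\Omega',d_e)$ for some domain $\Omega'\subseteq\mathbb{R}^n$. Furthermore, if $\Omega=\mathbb{R}^n$, then $\Omega'=\mathbb{R}^n$ (that is, $(\mathbb{R}^n,d_\nu)$ is bi-Lipschitz equivalent to $(\mathbb{R}^n,d_e)$).
   Context: A domain is a nonempty connected open set. $\mathcal{H}$ denotes the set of all hyperplanes ($(n-1)$-dimensional affine subspaces) in $\mathbb{R}^n$, with its standard topology and Borel structure. For $E\subseteq\mathbb{R}^n$, $\pi E\subseteq\mathcal{H}$ is the set of all hyperplanes that intersect $E$; $[x,y]$ is the closed line segment with endpoints $x,y$. A positive Borel measure $\nu$ on $\mathcal{H}$ is called admissible (for $\Omega$) if: (1) $\nu(\pi E)=0$ when $E$ is a one-point subset of $\Omega$; (2) $\nu(\pi E)>0$ when $E$ is a (nondegenerate) line segment in $\Omega$; (3) $\nu(\pi E)<\infty$ for every compact set $E\subset\Omega$. The Busemann-type projective metric on $\Omega$ is $d_\nu(x,y)=\nu(\pi[x,y])$. A modulus of quasisymmetry is a homeomorphism $\eta\colon[0,\infty)\to[0,\infty)$.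 A topological embedding $f\colon X\to\mathbb{R}^n$ of a metric space $(X,d_X)$ is $\eta$-quasisymmetric if for every triple of distinct points $a,b,x\in X$ one has $|f(x)-f(a)|\le\eta(t)\,|f(x)-f(b)|$ with $t=d_X(x,a)/d_X(x,b)$. The identity map $\mathrm{id}\colon(\Omega,d_\nu)\to(\Omega,d_e)$ is locally $\eta$-quasisymmetric if every point of $(\Omega,d_\nu)$ has a neighborhood on which it is $\eta$-quasisymmetric (with the same $\eta$ for all points). Two metric spaces are bi-Lipschitz equivalent if there is a bijection $F$ between them and a constant $L\ge1$ such that $L^{-1}d(x,y)\le d'(F(x),F(y))\le L\,d(x,y)$ for all $x,y$. *)

theory Defs
  imports "HOL-Analysis.Analysis"
begin

definition is_domain :: "'a::topological_space set \<Rightarrow> bool" where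
  "is_domain S \<longleftrightarrow> S \<noteq> {} \<and> connected S \<and> open S"


section \<open>The space of hyperplanes\<close>

definition hyperplanes :: "(real ^ 'n) set set" where
  "hyperplanes = {H. affine H \<and> aff_dim H = int CARD('n) - 1}"

definition hyperplane_of :: "(real ^ 'n) \<times> real \<Rightarrow> (real ^ 'n) set" where
  "hyperplane_of = (\<lambda>(u, t). {x. u \<bullet> x = t})"

text \<open>The standard topology on the set of hyperplanes is the quotient topology under the
  two-to-one parametrization by a unit normal \<open>u\<close> and an offset \<open>t\<close>; the pairs \<open>(u, t)\<close> and
  \<open>(- u, - t)\<close> give the same hyperplane. The lemma \<open>quotient_map_hyperplane_of\<close> below states
  this in terms of the library's quotient maps.\<close>

definition hyperplane_topology :: "(real ^ 'n) set topology" where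
  "hyperplane_topology = topology (\<lambda>\<U>. \<U> \<subseteq> hyperplanes \<and>
     openin (top_of_set (sphere 0 1 \<times> UNIV)) {p \<in> sphere 0 1 \<times> UNIV. hyperplane_of p \<in> \<U>})"

definition hyperplane_borel :: "(real ^ 'n) set measure" where
  "hyperplane_borel = sigma hyperplanes {\<U>. openin hyperplane_topology \<U>}"

definition hyperplanes_meeting :: "(real ^ 'n) set \<Rightarrow> (real ^ 'n) set set" where
  "hyperplanes_meeting E = {H \<in> hyperplanes. H \<inter> E \<noteq> {}}"

lemma hyperplanes_eq_image:
  "(hyperplanes :: (real ^ 'n) set set) = hyperplane_of ` (sphere 0 1 \<times> UNIV)"
proof (intro equalityI subsetI)
  fix H :: "(real ^ 'n) set"
  assume "H \<in> hyperplanes"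
  then have "affine H" and "aff_dim H = DIM(real ^ 'n) - 1"
    by (auto simp: hyperplanes_def)
  then obtain a b where "a \<noteq> 0" and H: "H = {x. a \<bullet> x = b}"
    unfolding aff_dim_eq_hyperplane by (metis affine_hull_eq)
  then have "H = hyperplane_of (a /\<^sub>R norm a, b / norm a)"
    by (auto simp: hyperplane_of_def field_simps)
  moreover have "a /\<^sub>R norm a \<in> sphere 0 1"
    using \<open>a \<noteq> 0\<close> by simp
  ultimately show "H \<in> hyperplane_of ` (sphere 0 1 \<times> UNIV)"
    by blast
next
  fix H :: "(real ^ 'n) set"
  assume "H \<in> hyperplane_of ` (sphere 0 1 \<times> UNIV)"
  then obtain u t where "norm u = 1" and H: "H = {x. u \<bullet> x = t}"
    by (auto simp: hyperplane_of_def)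
  then have "u \<noteq> 0"
    by auto
  then show "H \<in> hyperplanes"
    by (simp add: H hyperplanes_def affine_hyperplane)
qed

lemma openin_hyperplane_topology:
  fixes \<U> :: "(real ^ 'n) set set"
  shows "openin hyperplane_topology \<U> \<longleftrightarrow> \<U> \<subseteq> hyperplanes \<and>
     openin (top_of_set (sphere 0 1 \<times> UNIV)) {p \<in> sphere 0 1 \<times> UNIV. hyperplane_of p \<in> \<U>}"
proof -
  let ?S = "sphere 0 1 \<times> UNIV :: ((real ^ 'n) \<times> real) set"
  let ?P = "\<lambda>\<U>. {p \<in> ?S. hyperplane_of p \<in> \<U>}"
  have "istopology (\<lambda>\<U>. \<U> \<subseteq> hyperplanes \<and> openin (top_of_set ?S) (?P \<U>))"
    unfolding istopology_def
  proof (intro conjI allI impI)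
    fix \<U> \<V> :: "(real ^ 'n) set set"
    assume "\<U> \<subseteq> hyperplanes \<and> openin (top_of_set ?S) (?P \<U>)"
      and "\<V> \<subseteq> hyperplanes \<and> openin (top_of_set ?S) (?P \<V>)"
    moreover have "?P (\<U> \<inter> \<V>) = ?P \<U> \<inter> ?P \<V>"
      by auto
    ultimately show "\<U> \<inter> \<V> \<subseteq> hyperplanes" "openin (top_of_set ?S) (?P (\<U> \<inter> \<V>))"
      using openin_Int[of "top_of_set ?S" "?P \<U>" "?P \<V>"] by (blast, presburger)
  next
    fix K :: "(real ^ 'n) set set set"
    assume K: "\<forall>\<U>\<in>K. \<U> \<subseteq> hyperplanes \<and> openin (top_of_set ?S) (?P \<U>)"
    then show "\<Union>K \<subseteq> hyperplanes"
      by blast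
    have "?P (\<Union>K) = (\<Union>\<U>\<in>K. ?P \<U>)"
      by auto
    moreover have "openin (top_of_set ?S) (\<Union>\<U>\<in>K. ?P \<U>)"
      using K by (intro openin_Union ballI) (erule imageE, simp only:)
    ultimately show "openin (top_of_set ?S) (?P (\<Union>K))"
      by (simp only:)
  qed
  then show ?thesis
    by (simp add: hyperplane_topology_def topology_inverse')
qed

lemma topspace_hyperplane_topology:
  "topspace hyperplane_topology = (hyperplanes :: (real ^ 'n) set set)"
proof
  show "topspace hyperplane_topology \<subseteq> (hyperplanes :: (real ^ 'n) set set)"
    using openin_hyperplane_topology openin_topspace by blast
  have "{p \<in> sphere 0 1 \<times> UNIV. hyperplane_of p \<in> (hyperplanes :: (real ^ 'n) set set)} =
      sphere 0 1 \<times> UNIV"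
    using hyperplanes_eq_image by blast
  then have "openin hyperplane_topology (hyperplanes :: (real ^ 'n) set set)"
    unfolding openin_hyperplane_topology by simp
  then show "(hyperplanes :: (real ^ 'n) set set) \<subseteq> topspace hyperplane_topology"
    by (rule openin_subset)
qed

lemma quotient_map_hyperplane_of:
  "quotient_map (top_of_set (sphere 0 1 \<times> UNIV)) hyperplane_topology hyperplane_of"
  by (simp add: quotient_map_def topspace_hyperplane_topology hyperplanes_eq_image[symmetric]
      openin_hyperplane_topology)

lemma space_hyperplane_borel: "space hyperplane_borel = hyperplanes"
  by (simp add: hyperplane_borel_def space_measure_of_conv)

lemma closedin_hyperplanes_meeting:
  fixes K :: "(real ^ 'n) set"
  assumes "compact K"
  shows "closedin hyperplane_topology (hyperplanes_meeting K)"
proof -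
  let ?S = "sphere 0 1 \<times> UNIV :: ((real ^ 'n) \<times> real) set"
  let ?f = "\<lambda>(u, x). (u, u \<bullet> x) :: (real ^ 'n) \<times> real"
  have "compact (?f ` (sphere 0 1 \<times> K))"
    by (intro compact_continuous_image compact_Times compact_sphere assms)
      (auto simp: case_prod_beta intro!: continuous_intros)
  moreover have "{p \<in> ?S. hyperplane_of p \<in> hyperplanes_meeting K} = ?f ` (sphere 0 1 \<times> K)"
  proof (rule set_eqI)
    fix p :: "(real ^ 'n) \<times> real"
    obtain u t where p: "p = (u, t)"
      by (cases p)
    have "hyperplane_of p \<in> hyperplanes" if "p \<in> ?S"
      using that by (auto simp: hyperplanes_eq_image)
    then show "p \<in> {p \<in> ?S. hyperplane_of p \<in> hyperplanes_meeting K}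
        \<longleftrightarrow> p \<in> ?f ` (sphere 0 1 \<times> K)"
      unfolding p by (force simp: hyperplanes_meeting_def hyperplane_of_def)
  qed
  ultimately have "closedin (top_of_set ?S)
      {p \<in> topspace (top_of_set ?S). hyperplane_of p \<in> hyperplanes_meeting K}"
    by (auto intro!: closed_subset compact_imp_closed)
  moreover have "hyperplanes_meeting K \<subseteq> topspace hyperplane_topology"
    by (auto simp: topspace_hyperplane_topology hyperplanes_meeting_def)
  ultimately show ?thesis
    using quotient_map_hyperplane_of unfolding quotient_map_closedin by blast
qed

lemma hyperplanes_meeting_in_sets:
  fixes K :: "(real ^ 'n) set"
  assumes "compact K"
  shows "hyperplanes_meeting K \<in> sets hyperplane_borel"
proof -
  have "{\<U>. openin hyperplane_topology \<U>} \<subseteq> Pow (hyperplanes :: (real ^ 'n) set set)"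
    by (auto simp: openin_hyperplane_topology)
  then have "hyperplanes - hyperplanes_meeting K \<in> sets hyperplane_borel"
    using closedin_hyperplanes_meeting[OF assms]
    by (simp add: closedin_def topspace_hyperplane_topology hyperplane_borel_def
        sets_measure_of sigma_sets.Basic)
  then have "space hyperplane_borel - (hyperplanes - hyperplanes_meeting K)
      \<in> sets hyperplane_borel"
    by (rule sets.compl_sets)
  moreover have "hyperplanes - (hyperplanes - hyperplanes_meeting K) = hyperplanes_meeting K"
    by (auto simp: hyperplanes_meeting_def)
  ultimately show ?thesis
    by (simp add: space_hyperplane_borel)
qed


section \<open>Admissible measures and Busemann-type metrics\<close>

definition admissible :: "(real ^ 'n) set \<Rightarrow> (real ^ 'n) set measure \<Rightarrow> bool" where
  "admissible \<Omega> \<nu> \<longleftrightarrow>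
     sets \<nu> = sets hyperplane_borel \<and>
     (\<forall>x\<in>\<Omega>. emeasure \<nu> (hyperplanes_meeting {x}) = 0) \<and>
     (\<forall>x y. x \<noteq> y \<longrightarrow> closed_segment x y \<subseteq> \<Omega> \<longrightarrow>
        emeasure \<nu> (hyperplanes_meeting (closed_segment x y)) > 0) \<and>
     (\<forall>E. compact E \<longrightarrow> E \<subseteq> \<Omega> \<longrightarrow> emeasure \<nu> (hyperplanes_meeting E) < \<infinity>)"

text \<open>For \<open>x\<close>, \<open>y\<close> in a convex \<open>\<Omega>\<close> the measure is finite by admissibility, so nothing is lost
  by taking it real-valued; outside \<open>\<Omega>\<close> the value is irrelevant.\<close>

definition busemann_dist :: "(real ^ 'n) set measure \<Rightarrow> real ^ 'n \<Rightarrow> real ^ 'n \<Rightarrow> real" where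
  "busemann_dist \<nu> x y = measure \<nu> (hyperplanes_meeting (closed_segment x y))"


section \<open>Quasisymmetry and bi-Lipschitz equivalence\<close>

text \<open>Metric spaces are given, as in the library's locale \<open>Metric_space\<close>, by a carrier and a
  distance function.\<close>

definition qs_modulus :: "(real \<Rightarrow> real) \<Rightarrow> bool" where
  "qs_modulus \<eta> \<longleftrightarrow> (\<exists>\<theta>. homeomorphism {0..} {0..} \<eta> \<theta>)"

definition quasisymmetric ::
  "(real \<Rightarrow> real) \<Rightarrow> 'a set \<Rightarrow> ('a \<Rightarrow> 'a \<Rightarrow> real) \<Rightarrow> ('a \<Rightarrow> real ^ 'n) \<Rightarrow> bool" where
  "quasisymmetric \<eta> X d f \<longleftrightarrow>
     embedding_map (Metric_space.mtopology X d) euclidean f \<and>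
     (\<forall>a\<in>X. \<forall>b\<in>X. \<forall>x\<in>X. distinct [a, b, x] \<longrightarrow>
        norm (f x - f a) \<le> \<eta> (d x a / d x b) * norm (f x - f b))"

definition locally_quasisymmetric ::
  "(real \<Rightarrow> real) \<Rightarrow> 'a set \<Rightarrow> ('a \<Rightarrow> 'a \<Rightarrow> real) \<Rightarrow> ('a \<Rightarrow> real ^ 'n) \<Rightarrow> bool" where
  "locally_quasisymmetric \<eta> X d f \<longleftrightarrow>
     (\<forall>p\<in>X. \<exists>U V. openin (Metric_space.mtopology X d) V \<and> p \<in> V \<and> V \<subseteq> U \<and> U \<subseteq> X \<and>
        quasisymmetric \<eta> U d f)"

definition bilipschitz_equivalent ::
  "'a set \<Rightarrow> ('a \<Rightarrow> 'a \<Rightarrow> real) \<Rightarrow> 'b set \<Rightarrow> ('b \<Rightarrow> 'b \<Rightarrow> real) \<Rightarrow> bool" where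
  "bilipschitz_equivalent X d Y d' \<longleftrightarrow>
     (\<exists>F L. bij_betw F X Y \<and> L \<ge> 1 \<and>
        (\<forall>x\<in>X. \<forall>y\<in>X. inverse L * d x y \<le> d' (F x) (F y) \<and> d' (F x) (F y) \<le> L * d x y))"

end

theory Submission
  imports Defs
begin

text \<open>Orient every hyperplane \<open>H\<close> by its unit normal \<open>N\<^sub>H\<close> pointing away from a base point \<open>p\<close>, and let
  \<open>F(x) = \<integral> N\<^sub>H d\<nu>(H)\<close> over the hyperplanes crossing \<open>[p, x]\<close>. Then \<open>\<bar>F(x) - F(y)\<bar> \<le> d(x, y)\<close>, while
  \<open>\<langle>F(x) - F(y), x - y\<rangle>\<close> is the integral of \<open>\<bar>\<langle>N\<^sub>H, x - y\<rangle>\<bar>\<close> over the hyperplanes crossing \<open>[x, y]\<close>.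
  Those crossing \<open>[x, y]\<close> at an angle less than \<open>\<theta>\<close> meet the ball of radius \<open>\<theta> \<bar>x - y\<bar>\<close> around \<open>x\<close>, so
  quasisymmetry makes their measure at most half of \<open>d(x, y)\<close> when \<open>x\<close> and \<open>y\<close> are close; hence
  \<open>\<langle>F(x) - F(y), x - y\<rangle> \<ge> c \<bar>x - y\<bar> d(x, y)\<close> locally, and globally by additivity along segments.
  So \<open>F\<close> is bi-Lipschitz, and its image is open by invariance of domain.

  If \<open>\<Omega>\<close> is the whole space, \<open>F\<close> is onto as soon as \<open>d(0, x) \<rightarrow> \<infinity>\<close> as \<open>x \<rightarrow> \<infinity>\<close>. The map \<open>F\<close> is the
  gradient of a convex function whose second differences in any two directions are comparable at
  small scales. Second differences over parallelograms are additive under subdivision, so this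
  comparison passes to all scales. It follows that metric balls are uniformly round at all scales,
  and then \<open>d(0, 2v) \<ge> (1 + 1/A) d(0, v)\<close>.\<close>

section \<open>Hyperplanes\<close>

lemma hyperplanesE:
  fixes H :: "(real ^ 'n) set"
  assumes "H \<in> hyperplanes"
  obtains u t where "norm u = 1" "H = {x. u \<bullet> x = t}"
  using assms unfolding hyperplanes_eq_image hyperplane_of_def by auto

lemma infdist_hyperplane:
  fixes u :: "'a::real_inner"
  assumes "norm u = 1"
  shows "infdist x {y. u \<bullet> y = t} = \<bar>u \<bullet> x - t\<bar>"
proof (rule antisym)
  let ?z = "x - (u \<bullet> x - t) *\<^sub>R u"
  have uu: "u \<bullet> u = 1"
    using assms by (simp add: norm_eq_1)
  then have "?z \<in> {y. u \<bullet> y = t}"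
    by (simp add: inner_diff_right)
  then have "infdist x {y. u \<bullet> y = t} \<le> dist x ?z"
    by (rule infdist_le)
  then show "infdist x {y. u \<bullet> y = t} \<le> \<bar>u \<bullet> x - t\<bar>"
    by (simp add: dist_norm assms)
  have "\<bar>u \<bullet> x - t\<bar> \<le> dist x y" if "u \<bullet> y = t" for y
    using Cauchy_Schwarz_ineq2[of u "x - y"] that assms
    by (simp add: dist_norm inner_diff_right)
  moreover have "{y. u \<bullet> y = t} \<noteq> {}"
    using \<open>?z \<in> _\<close> by blast
  ultimately show "\<bar>u \<bullet> x - t\<bar> \<le> infdist x {y. u \<bullet> y = t}"
    by (auto simp: infdist_notempty intro!: cINF_greatest)
qed

text \<open>An affine function vanishes somewhere on a segment exactly when its end values do not
  share a strict sign. This turns later questions about crossings into arithmetic with signed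
  distances.\<close>

lemma hyperplane_Int_closed_segment_iff:
  fixes u :: "'a::real_inner"
  shows "{z. u \<bullet> z = t} \<inter> closed_segment x y \<noteq> {} \<longleftrightarrow> (u \<bullet> x - t) * (u \<bullet> y - t) \<le> 0"
proof
  assume "{z. u \<bullet> z = t} \<inter> closed_segment x y \<noteq> {}"
  then obtain s where s: "0 \<le> s" "s \<le> 1" "u \<bullet> ((1 - s) *\<^sub>R x + s *\<^sub>R y) = t"
    by (auto simp: closed_segment_def)
  then have "(1 - s) * (u \<bullet> x - t) + s * (u \<bullet> y - t) = 0"
    by (simp add: inner_add_right algebra_simps)
  moreover have False if "u \<bullet> x - t > 0" "u \<bullet> y - t > 0"
    using that s calculation
    by (smt (verit) mult_nonneg_nonneg mult_pos_pos)
  moreover have False if "u \<bullet> x - t < 0" "u \<bullet> y - t < 0"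
    using that s calculation
    by (smt (verit) mult_nonneg_nonpos mult_pos_neg)
  ultimately show "(u \<bullet> x - t) * (u \<bullet> y - t) \<le> 0"
    by (meson mult_le_0_iff not_le less_imp_le)
next
  assume le: "(u \<bullet> x - t) * (u \<bullet> y - t) \<le> 0"
  \<comment> \<open>The zero of the affine function along the segment. If the end values agree,
    \<open>le\<close> forces both to be \<open>t\<close>, so the parameter 0 serves.\<close>
  define s where "s = (if u \<bullet> x = u \<bullet> y then 0 else (u \<bullet> x - t) / (u \<bullet> x - u \<bullet> y))"
  have "0 \<le> s \<and> s \<le> 1 \<and> (1 - s) * (u \<bullet> x) + s * (u \<bullet> y) = t"
  proof (cases "u \<bullet> x = u \<bullet> y")
    case True
    then show ?thesis
      using le by (auto simp: s_def mult_le_0_iff)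
  next
    case False
    with le show ?thesis
      by (auto simp: s_def mult_le_0_iff divide_simps) (simp_all add: algebra_simps)
  qed
  then have "(1 - s) *\<^sub>R x + s *\<^sub>R y \<in> {z. u \<bullet> z = t} \<inter> closed_segment x y"
    by (auto simp: closed_segment_def inner_add_right intro!: exI[of _ s])
  then show "{z. u \<bullet> z = t} \<inter> closed_segment x y \<noteq> {}"
    by blast
qed

lemma mem_hyperplanes_meeting_segment_iff:
  fixes H :: "(real ^ 'n) set"
  assumes "H \<in> hyperplanes" "H = {z. u \<bullet> z = t}"
  shows "H \<in> hyperplanes_meeting (closed_segment x y) \<longleftrightarrow> (u \<bullet> x - t) * (u \<bullet> y - t) \<le> 0"
  using assms hyperplane_Int_closed_segment_iff[of u t x y]
  by (simp add: hyperplanes_meeting_def)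

lemma hyperplanes_meeting_Un:
  "hyperplanes_meeting (A \<union> B) = hyperplanes_meeting A \<union> hyperplanes_meeting B"
  by (auto simp: hyperplanes_meeting_def)

lemma hyperplanes_meeting_mono: "A \<subseteq> B \<Longrightarrow> hyperplanes_meeting A \<subseteq> hyperplanes_meeting B"
  by (auto simp: hyperplanes_meeting_def)

lemma hyperplanes_meeting_Int_hyperplanes [simp]:
  "hyperplanes_meeting E \<inter> hyperplanes = hyperplanes_meeting E"
  by (auto simp: hyperplanes_meeting_def)

lemma hyperplanes_meeting_triangle:
  fixes x y z :: "real ^ 'n"
  shows "hyperplanes_meeting (closed_segment x z)
    \<subseteq> hyperplanes_meeting (closed_segment x y) \<union> hyperplanes_meeting (closed_segment y z)"
proof
  fix H :: "(real ^ 'n) set"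
  assume H: "H \<in> hyperplanes_meeting (closed_segment x z)"
  then have "H \<in> hyperplanes"
    by (simp add: hyperplanes_meeting_def)
  then obtain u t where "H = {x. u \<bullet> x = t}"
    using hyperplanesE by metis
  note iff = mem_hyperplanes_meeting_segment_iff[OF \<open>H \<in> hyperplanes\<close> this]
  show "H \<in> hyperplanes_meeting (closed_segment x y) \<union> hyperplanes_meeting (closed_segment y z)"
    using H unfolding Un_iff iff by (auto simp: mult_le_0_iff)
qed

lemma infdist_le_dist_crossing:
  fixes H :: "(real ^ 'n) set"
  assumes "H \<in> hyperplanes_meeting (closed_segment x y)"
  shows "infdist x H \<le> dist x y" "infdist y H \<le> dist x y"
proof -
  obtain z where z: "z \<in> H" "z \<in> closed_segment x y"
    using assms by (auto simp: hyperplanes_meeting_def)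
  then show "infdist x H \<le> dist x y" "infdist y H \<le> dist x y"
    using infdist_le[OF z(1), of x] infdist_le[OF z(1), of y]
      dist_in_closed_segment[OF z(2)] by (auto simp: dist_commute)
qed

text \<open>Needed twice: sublevel sets of the distance become sets of hyperplanes meeting a compact
  ball, hence measurable, and hyperplanes passing close to a point become those meeting a small
  ball.\<close>

lemma mem_hyperplanes_meeting_cball_iff:
  fixes H :: "(real ^ 'n) set"
  assumes "H \<in> hyperplanes"
  shows "H \<in> hyperplanes_meeting (cball x r) \<longleftrightarrow> infdist x H \<le> r"
proof -
  obtain u t where u: "norm u = 1" and H: "H = {x. u \<bullet> x = t}"
    using assms by (rule hyperplanesE)
  have "closed H"
    by (simp add: H closed_hyperplane)
  have "H \<noteq> {}"
    using u by (auto simp: H hyperplane_eq_Ex intro!: exI[of _ "t *\<^sub>R u"] simp: norm_eq_1)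
  show ?thesis
  proof
    assume "H \<in> hyperplanes_meeting (cball x r)"
    then show "infdist x H \<le> r"
      by (auto simp: hyperplanes_meeting_def intro: infdist_le2)
  next
    assume "infdist x H \<le> r"
    moreover obtain y where "y \<in> H" "infdist x H = dist x y"
      using infdist_attains_inf[OF \<open>closed H\<close> \<open>H \<noteq> {}\<close>] by blast
    ultimately show "H \<in> hyperplanes_meeting (cball x r)"
      using assms by (auto simp: hyperplanes_meeting_def)
  qed
qed

text \<open>A unit normal has a coordinate of modulus at least \<open>1/n\<close>, since otherwise
  its l1 norm would be below 1. Moving by \<open>n * r\<close> along that axis, in one of the two
  senses, therefore reaches every hyperplane within distance \<open>r\<close> of \<open>x\<close>.
  The measure of a ball is thus controlled by \<open>2 * n\<close> segments.\<close>

lemma hyperplanes_meeting_cball_subset: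
  fixes x :: "real ^ 'n"
  assumes "0 \<le> r"
  defines "\<rho> \<equiv> of_nat CARD('n) * r"
  shows "hyperplanes_meeting (cball x r) \<subseteq>
    (\<Union>i\<in>UNIV. hyperplanes_meeting (closed_segment x (x + \<rho> *\<^sub>R axis i 1)) \<union>
      hyperplanes_meeting (closed_segment x (x - \<rho> *\<^sub>R axis i 1)))"
proof
  fix H :: "(real ^ 'n) set"
  assume *: "H \<in> hyperplanes_meeting (cball x r)"
  then have H: "H \<in> hyperplanes"
    by (simp add: hyperplanes_meeting_def)
  then obtain u t where u: "norm u = 1" and Hu: "H = {x. u \<bullet> x = t}"
    by (rule hyperplanesE)
  have le: "\<bar>u \<bullet> x - t\<bar> \<le> r"
    using * mem_hyperplanes_meeting_cball_iff[OF H, of x r] infdist_hyperplane[OF u] Hu by simp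
  have "\<exists>i. \<bar>u $ i\<bar> \<ge> 1 / of_nat CARD('n)"
  proof (rule ccontr)
    assume "\<not> ?thesis"
    then have "(\<Sum>i\<in>UNIV. \<bar>u $ i\<bar>) < (\<Sum>i\<in>(UNIV::'n set). 1 / of_nat CARD('n))"
      by (intro sum_strict_mono) (auto simp: not_le)
    then show False
      using norm_le_l1_cart[of u] u by simp
  qed
  then obtain i where i: "\<bar>u $ i\<bar> \<ge> 1 / of_nat CARD('n)" ..
  have "r \<le> \<rho> * \<bar>u $ i\<bar>"
    using mult_left_mono[OF i, of \<rho>] assms by (simp add: \<rho>_def)
  then have "\<bar>u \<bullet> x - t\<bar> \<le> \<bar>\<rho> * (u $ i)\<bar>"
    using le assms by (simp add: abs_mult \<rho>_def)
  moreover define a b where "a = u \<bullet> x - t" and "b = \<rho> * (u $ i)"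
  ultimately have "\<bar>a\<bar> \<le> \<bar>b\<bar>" by simp
  then have "a * (a + b) \<le> 0 \<or> a * (a - b) \<le> 0"
    unfolding mult_le_0_iff by linarith
  then show "H \<in> (\<Union>i\<in>UNIV. hyperplanes_meeting (closed_segment x (x + \<rho> *\<^sub>R axis i 1)) \<union>
      hyperplanes_meeting (closed_segment x (x - \<rho> *\<^sub>R axis i 1)))"
    by (auto simp: mem_hyperplanes_meeting_segment_iff[OF H Hu] inner_add_right inner_diff_right
        inner_axis a_def b_def algebra_simps intro!: exI[of _ i])
qed

section \<open>Unit normals directed away from a base point\<close>

text \<open>The direction to the foot of the perpendicular avoids choosing between the two unit
  normals. If \<open>p\<close> lies on \<open>H\<close>, the value is 0.\<close>

definition away_normal :: "real ^ 'n \<Rightarrow> (real ^ 'n) set \<Rightarrow> real ^ 'n" where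
  "away_normal p H = sgn (closest_point H p - p)"

lemma away_normal_hyperplane:
  fixes p u :: "real ^ 'n"
  assumes u: "norm u = 1"
  shows "away_normal p {x. u \<bullet> x = t} = sgn (t - u \<bullet> p) *\<^sub>R u"
proof -
  let ?H = "{x. u \<bullet> x = t}" and ?z = "p - (u \<bullet> p - t) *\<^sub>R u"
  have uu: "u \<bullet> u = 1"
    using u by (simp add: norm_eq_1)
  have "?z = closest_point ?H p"
  proof (rule closest_point_unique)
    show "?z \<in> ?H"
      by (simp add: inner_diff_right uu)
    show "\<forall>y\<in>?H. dist p ?z \<le> dist p y"
    proof
      fix y assume "y \<in> ?H"
      then show "dist p ?z \<le> dist p y"
        using infdist_le[of y ?H p] infdist_hyperplane[OF u, of p t] by (simp add: dist_norm u)
    qed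
  qed (auto simp: convex_hyperplane closed_hyperplane)
  then have "closest_point ?H p - p = (t - u \<bullet> p) *\<^sub>R u"
    by (simp add: algebra_simps flip: \<open>?z = _\<close>)
  then show ?thesis
    by (simp add: away_normal_def sgn_scaleR sgn_div_norm[of u] u)
qed

lemma away_normalE:
  fixes H :: "(real ^ 'n) set"
  assumes "H \<in> hyperplanes" "p \<notin> H"
  obtains t where "norm (away_normal p H) = 1" "H = {x. away_normal p H \<bullet> x = t}"
    "away_normal p H \<bullet> p < t"
proof -
  obtain u t where u: "norm u = 1" and H: "H = {x. u \<bullet> x = t}"
    using assms(1) by (rule hyperplanesE)
  have ne: "u \<bullet> p \<noteq> t"
    using assms(2) H by auto
  have eq: "away_normal p H = sgn (t - u \<bullet> p) *\<^sub>R u"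
    unfolding H by (rule away_normal_hyperplane[OF u])
  consider "t > u \<bullet> p" | "t < u \<bullet> p"
    using ne by linarith
  then show thesis
  proof cases
    case 1
    then show ?thesis using that[of t] eq u H by simp
  next
    case 2
    then show ?thesis using that[of "-t"] eq u H by auto
  qed
qed

lemma norm_away_normal_le: "norm (away_normal p H) \<le> 1"
  by (simp add: away_normal_def norm_sgn)

text \<open>As long as \<open>p + e / (k + 1)\<close> stays on the side of \<open>p\<close>, the
  distance to \<open>H\<close> is affine, so the quotients are eventually constant. Writing the
  normal as a limit of distances is what later makes it measurable in \<open>H\<close>.\<close>

lemma away_normal_inner_eq_limit:
  fixes p e :: "real ^ 'n"
  assumes "H \<in> hyperplanes" "p \<notin> H"
  shows "(\<lambda>k. real (Suc k) * (infdist p H - infdist (p + (1 / real (Suc k)) *\<^sub>R e) H))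
    \<longlonglongrightarrow> away_normal p H \<bullet> e"
proof -
  obtain t where n: "norm (away_normal p H) = 1" and Ht: "H = {x. away_normal p H \<bullet> x = t}"
    and lt: "away_normal p H \<bullet> p < t"
    using away_normalE[OF assms] .
  define N where "N = away_normal p H"
  have d: "infdist z H = \<bar>N \<bullet> z - t\<bar>" for z
    using infdist_hyperplane[OF n, of z t] Ht by (simp add: N_def)
  have "(\<lambda>k. 1 / real (Suc k) * (N \<bullet> e)) \<longlonglongrightarrow> 0 * (N \<bullet> e)"
    by (intro tendsto_mult tendsto_const LIMSEQ_Suc lim_const_over_n)
  then have "\<forall>\<^sub>F k in sequentially. 1 / real (Suc k) * (N \<bullet> e) < t - N \<bullet> p"
    using lt by (intro order_tendstoD(2)) (auto simp: N_def)
  then have "\<forall>\<^sub>F k in sequentially.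
      N \<bullet> e = real (Suc k) * (infdist p H - infdist (p + (1 / real (Suc k)) *\<^sub>R e) H)"
  proof eventually_elim
    case (elim k)
    have "infdist p H - infdist (p + (1 / real (Suc k)) *\<^sub>R e) H = 1 / real (Suc k) * (N \<bullet> e)"
      using elim lt unfolding d by (simp add: N_def inner_add_right)
    then show ?case
      by (simp del: of_nat_Suc)
  qed
  then show ?thesis
    unfolding N_def by (rule Lim_transform_eventually[OF tendsto_const])
qed

text \<open>The normal \<open>N\<close> points away from \<open>p\<close>, so \<open>H\<close>
  crosses \<open>[p, z]\<close> exactly when \<open>N \<bullet> z \<ge> t\<close>. The difference of
  the indicators is therefore nonzero only if \<open>H\<close> separates \<open>x\<close> from
  \<open>y\<close>; its sign is then that of \<open>N \<bullet> (x - y)\<close>, whose modulus is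
  the sum of the two distances.\<close>

lemma crossing_difference:
  fixes p x y :: "real ^ 'n"
  assumes H: "H \<in> hyperplanes" and notin: "p \<notin> H" "x \<notin> H" "y \<notin> H"
  defines "I \<equiv> (\<lambda>a b. indicator (hyperplanes_meeting (closed_segment a b)) H :: real)"
  shows "\<bar>I p x - I p y\<bar> = I x y"
    and "(I p x - I p y) * (away_normal p H \<bullet> (x - y)) = I x y * (infdist x H + infdist y H)"
proof -
  obtain t where n: "norm (away_normal p H) = 1" and Ht: "H = {x. away_normal p H \<bullet> x = t}"
    and lt: "away_normal p H \<bullet> p < t"
    using away_normalE[OF H notin(1)] .
  define N where "N = away_normal p H"
  note iff = mem_hyperplanes_meeting_segment_iff[OF H Ht, folded N_def]
  have ne: "N \<bullet> x \<noteq> t" "N \<bullet> y \<noteq> t"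
    using notin Ht by (auto simp: N_def)
  have d: "infdist z H = \<bar>N \<bullet> z - t\<bar>" for z
    using infdist_hyperplane[OF n, of z t] Ht by (simp add: N_def)
  have lt': "N \<bullet> p < t" using lt by (simp add: N_def)
  have I1: "I p z = (if N \<bullet> z \<ge> t then 1 else 0)" for z
    using lt' by (auto simp: I_def indicator_def iff mult_le_0_iff)
  have I2: "I x y = (if (N \<bullet> x \<ge> t) \<noteq> (N \<bullet> y \<ge> t) then 1 else 0)"
    using ne by (auto simp: I_def indicator_def iff mult_le_0_iff)
  show "\<bar>I p x - I p y\<bar> = I x y"
    unfolding I1 I2 by auto
  show "(I p x - I p y) * (away_normal p H \<bullet> (x - y)) = I x y * (infdist x H + infdist y H)"
    unfolding I1 I2 d N_def[symmetric] using ne by (auto simp: inner_diff_right)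
qed

section \<open>The projective metric of an admissible measure\<close>

locale admissible_measure =
  fixes \<Omega> :: "(real ^ 'n) set" and \<nu> :: "(real ^ 'n) set measure"
  assumes convex: "convex \<Omega>" and open_dom: "open \<Omega>" and adm: "admissible \<Omega> \<nu>"
begin

abbreviation d :: "real ^ 'n \<Rightarrow> real ^ 'n \<Rightarrow> real" where
  "d \<equiv> busemann_dist \<nu>"

abbreviation crossing :: "real ^ 'n \<Rightarrow> real ^ 'n \<Rightarrow> (real ^ 'n) set set" where
  "crossing x y \<equiv> hyperplanes_meeting (closed_segment x y)"

lemma sets_eq: "sets \<nu> = sets hyperplane_borel"
  using adm by (simp add: admissible_def)

lemma space_eq [simp]: "space \<nu> = hyperplanes"
  using sets_eq_imp_space_eq[OF sets_eq] by (simp add: space_hyperplane_borel)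

lemma meeting_sets [measurable, simp]: "compact K \<Longrightarrow> hyperplanes_meeting K \<in> sets \<nu>"
  by (simp add: sets_eq hyperplanes_meeting_in_sets)

lemma meeting_fmeasurable: "compact K \<Longrightarrow> K \<subseteq> \<Omega> \<Longrightarrow> hyperplanes_meeting K \<in> fmeasurable \<nu>"
  using adm by (auto simp: admissible_def fmeasurable_def)

lemma segment_subset: "x \<in> \<Omega> \<Longrightarrow> y \<in> \<Omega> \<Longrightarrow> closed_segment x y \<subseteq> \<Omega>"
  using convex by (simp add: closed_segment_subset)

lemma crossing_fmeasurable: "x \<in> \<Omega> \<Longrightarrow> y \<in> \<Omega> \<Longrightarrow> crossing x y \<in> fmeasurable \<nu>"
  by (simp add: meeting_fmeasurable segment_subset)

lemma AE_notin: "x \<in> \<Omega> \<Longrightarrow> AE H in \<nu>. x \<notin> H"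
proof (rule AE_I')
  assume "x \<in> \<Omega>"
  then show "hyperplanes_meeting {x} \<in> null_sets \<nu>"
    using adm by (auto simp: admissible_def null_sets_def)
qed (auto simp: hyperplanes_meeting_def)

lemma AE_in_hyperplanes: "AE H in \<nu>. H \<in> hyperplanes"
  using AE_space[of \<nu>] by simp

lemma borel_measurable_infdist_hyperplane [measurable]: "(\<lambda>H. infdist x H) \<in> borel_measurable \<nu>"
proof (rule borel_measurable_iff_le[THEN iffD2], rule allI)
  fix a :: real
  have "{H \<in> space \<nu>. infdist x H \<le> a} = hyperplanes_meeting (cball x a)"
    using mem_hyperplanes_meeting_cball_iff[of _ x a]
    by (auto simp: hyperplanes_meeting_def)
  then show "{H \<in> space \<nu>. infdist x H \<le> a} \<in> sets \<nu>"
    by simp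
qed

section \<open>Metric axioms, additivity along segments and continuity of \<open>d\<close>\<close>

lemma d_nonneg: "0 \<le> d x y"
  by (simp add: busemann_dist_def)

lemma d_commute: "d x y = d y x"
  by (simp add: busemann_dist_def closed_segment_commute)

lemma d_self: "x \<in> \<Omega> \<Longrightarrow> d x x = 0"
  using adm by (simp add: busemann_dist_def admissible_def measure_def)

lemma emeasure_meeting:
  assumes "compact K" "K \<subseteq> \<Omega>"
  shows "emeasure \<nu> (hyperplanes_meeting K) = ennreal (measure \<nu> (hyperplanes_meeting K))"
  using meeting_fmeasurable[OF assms]
  by (intro emeasure_eq_ennreal_measure) (simp add: fmeasurable_def less_top)

lemma d_pos: "x \<in> \<Omega> \<Longrightarrow> y \<in> \<Omega> \<Longrightarrow> x \<noteq> y \<Longrightarrow> 0 < d x y"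
  using adm segment_subset[of x y] emeasure_meeting[of "closed_segment x y"]
  unfolding busemann_dist_def admissible_def by (metis compact_segment ennreal_less_zero_iff)

lemma d_triangle:
  assumes "x \<in> \<Omega>" "y \<in> \<Omega>" "z \<in> \<Omega>"
  shows "d x z \<le> d x y + d y z"
proof -
  have "measure \<nu> (crossing x z) \<le> measure \<nu> (crossing x y \<union> crossing y z)"
    using assms by (intro measure_mono_fmeasurable hyperplanes_meeting_triangle fmeasurable.Un
        crossing_fmeasurable) auto
  also have "\<dots> \<le> measure \<nu> (crossing x y) + measure \<nu> (crossing y z)"
    using assms by (intro measure_Un_le) auto
  finally show ?thesis by (simp add: busemann_dist_def)
qed

text \<open>A hyperplane crossing both halves must pass through \<open>y\<close>, and such
  hyperplanes form a null set. So segments are geodesics of \<open>d\<close>.\<close>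

lemma d_add:
  assumes "x \<in> \<Omega>" "z \<in> \<Omega>" "y \<in> closed_segment x z"
  shows "d x z = d x y + d y z"
proof (rule antisym)
  have y: "y \<in> \<Omega>"
    using assms segment_subset by blast
  then show "d x z \<le> d x y + d y z"
    using assms by (intro d_triangle)
  have "AE H in \<nu>. H \<notin> crossing x y \<inter> crossing y z"
    using AE_notin[OF y] AE_in_hyperplanes
  proof eventually_elim
    case (elim H)
    then obtain u t where H: "H = {x. u \<bullet> x = t}"
      using hyperplanesE by metis
    from assms(3) obtain s where s: "0 \<le> s" "s \<le> 1" and ys: "y = (1 - s) *\<^sub>R x + s *\<^sub>R z"
      by (auto simp: closed_segment_def)
    define a b c where "a = u \<bullet> x - t" and "b = u \<bullet> y - t" and "c = u \<bullet> z - t"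
    have b: "b = (1 - s) * a + s * c"
      by (simp add: a_def b_def c_def ys inner_add_right algebra_simps)
    have "b \<noteq> 0"
      using elim H by (simp add: b_def)
    moreover have "\<not> (a \<ge> 0 \<and> c \<ge> 0 \<and> b < 0)" "\<not> (a \<le> 0 \<and> c \<le> 0 \<and> b > 0)"
      using s unfolding b by (auto simp: not_less intro!: add_nonneg_nonneg add_nonpos_nonpos mult_nonneg_nonpos)
    ultimately have "\<not> (a * b \<le> 0 \<and> b * c \<le> 0)"
      by (auto simp: mult_le_0_iff)
    then show ?case
      by (simp add: mem_hyperplanes_meeting_segment_iff[OF _ H] elim a_def b_def c_def)
  qed
  then have "crossing x y \<inter> crossing y z \<in> null_sets \<nu>"
    by (intro AE_iff_null_sets[THEN iffD2] sets.Int) auto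
  then have "measure \<nu> (crossing x y \<inter> crossing y z) = 0"
    by (simp add: measure_eq_0_null_sets)
  then have "measure \<nu> (crossing x y \<union> crossing y z) = d x y + d y z"
    using assms y
    by (subst measure_Un3) (auto simp: crossing_fmeasurable busemann_dist_def)
  moreover have "closed_segment x y \<union> closed_segment y z = closed_segment x z"
    using assms(3) by (rule Un_closed_segment)
  then have "crossing x y \<union> crossing y z = crossing x z"
    by (simp flip: hyperplanes_meeting_Un)
  ultimately show "d x y + d y z \<le> d x z"
    by (simp add: busemann_dist_def)
qed

lemma Metric_space_d: "Metric_space \<Omega> d"
proof
  fix x y assume "x \<in> \<Omega>" "y \<in> \<Omega>"
  then show "d x y = 0 \<longleftrightarrow> x = y"
    using d_pos d_self by (metis less_irrefl)
qed (auto simp: d_nonneg d_commute d_triangle)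

text \<open>Continuity of the measure from above: the hyperplanes meeting shrinking balls around
  \<open>x\<close> decrease to those through \<open>x\<close>, a null set. Hence Euclidean closeness
  implies closeness in \<open>d\<close>.\<close>

lemma d_small:
  assumes "x \<in> \<Omega>" "0 < e"
  obtains \<delta> where "0 < \<delta>" "ball x \<delta> \<subseteq> \<Omega>" "\<And>y. dist x y < \<delta> \<Longrightarrow> d x y < e"
proof -
  obtain r where r: "0 < r" "cball x r \<subseteq> \<Omega>"
    using open_dom assms(1) by (auto simp: open_contains_cball)
  define A where "A n = hyperplanes_meeting (cball x (r / real (Suc n)))" for n
  have sub: "cball x (r / real (Suc n)) \<subseteq> \<Omega>" for n
    using r by (intro order.trans[OF _ r(2)] subset_cball) (auto simp: field_simps)
  have "(\<lambda>n. emeasure \<nu> (A n)) \<longlonglongrightarrow> emeasure \<nu> (\<Inter>n. A n)"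
  proof (rule Lim_emeasure_decseq)
    show "range A \<subseteq> sets \<nu>"
      by (auto simp: A_def)
    have "r / real (Suc n) \<le> r / real (Suc m)" if "m \<le> n" for m n
      using r that by (intro divide_left_mono) auto
    then show "decseq A"
      unfolding A_def decseq_def by (intro allI impI hyperplanes_meeting_mono subset_cball) simp
    show "emeasure \<nu> (A n) \<noteq> \<infinity>" for n
      using meeting_fmeasurable[OF compact_cball sub] by (simp add: A_def fmeasurable_def less_top)
  qed
  moreover have "(\<Inter>n. A n) \<subseteq> hyperplanes_meeting {x}"
  proof
    fix H assume H: "H \<in> (\<Inter>n. A n)"
    then have hyp: "H \<in> hyperplanes"
      by (auto simp: A_def hyperplanes_meeting_def)
    then have "infdist x H \<le> r / real (Suc n)" for n
      using H mem_hyperplanes_meeting_cball_iff[OF hyp] by (auto simp: A_def)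
    moreover have "(\<lambda>n. r / real (Suc n)) \<longlonglongrightarrow> 0"
      by (rule LIMSEQ_Suc) (rule lim_const_over_n)
    ultimately have "infdist x H \<le> 0"
      using LIMSEQ_le_const[of "\<lambda>n. r / real (Suc n)" 0 "infdist x H"] by auto
    moreover have "closed H" "H \<noteq> {}"
      using hyp by (auto simp: hyperplanes_def affine_closed)
    ultimately have "x \<in> H"
      using infdist_nonneg[of x H] by (simp add: in_closed_iff_infdist_zero)
    then show "H \<in> hyperplanes_meeting {x}"
      using hyp by (simp add: hyperplanes_meeting_def)
  qed
  then have "emeasure \<nu> (\<Inter>n. A n) = 0"
    using assms(1) adm emeasure_mono[OF _ meeting_sets[of "{x}"], of "\<Inter>n. A n"]
    by (simp add: admissible_def)
  ultimately have "eventually (\<lambda>n. emeasure \<nu> (A n) < ennreal e) sequentially"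
    using assms(2) by (intro order_tendstoD(2)) auto
  then obtain n where n: "emeasure \<nu> (A n) < ennreal e"
    using eventually_happens by force
  show thesis
  proof (rule that)
    show "0 < r / real (Suc n)"
      using r by simp
    show "ball x (r / real (Suc n)) \<subseteq> \<Omega>"
      using sub[of n] ball_subset_cball by blast
    fix y assume "dist x y < r / real (Suc n)"
    then have "closed_segment x y \<subseteq> cball x (r / real (Suc n))"
      using r by (intro closed_segment_subset) auto
    then have "d x y \<le> measure \<nu> (A n)"
      unfolding busemann_dist_def A_def
      by (intro measure_mono_fmeasurable hyperplanes_meeting_mono meeting_fmeasurable sub) auto
    also have "\<dots> < e"
      using n emeasure_meeting[OF compact_cball sub[of n]] assms(2)
      by (simp add: A_def ennreal_less_iff)
    finally show "d x y < e" .
  qed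
qed

section \<open>The monotone map of an admissible measure\<close>

lemma borel_measurable_away_normal [measurable]: "away_normal p \<in> borel_measurable \<nu>"
proof -
  have "(\<lambda>H. away_normal p H \<bullet> e) \<in> borel_measurable \<nu>" for e
  proof (rule borel_measurable_LIMSEQ_real)
    \<comment> \<open>The case \<open>p \<in> H\<close> is split off: there the normal is 0 by
      convention, whereas the difference quotients need not tend to 0.\<close>
    let ?f = "\<lambda>k H. if infdist p H = 0 then 0
      else real (Suc k) * (infdist p H - infdist (p + (1 / real (Suc k)) *\<^sub>R e) H)"
    show "?f k \<in> borel_measurable \<nu>" for k
      by measurable
    fix H assume "H \<in> space \<nu>"
    then have H: "H \<in> hyperplanes"
      by simp
    then have cl: "closed H" "H \<noteq> {}"
      by (auto simp: hyperplanes_def affine_closed)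
    show "(\<lambda>k. ?f k H) \<longlonglongrightarrow> away_normal p H \<bullet> e"
    proof (cases "p \<in> H")
      case True
      then show ?thesis
        by (simp add: away_normal_def closest_point_self)
    next
      case False
      then have "infdist p H \<noteq> 0"
        using cl by (simp add: in_closed_iff_infdist_zero)
      then show ?thesis
        using away_normal_inner_eq_limit[OF H False, of e] by simp
    qed
  qed
  then show ?thesis
    by (auto simp: borel_measurable_euclidean_space[of "away_normal p"])
qed

text \<open>By \<open>crossing_difference\<close>, the integrand is the modulus of the normal
  component of \<open>x - y\<close> for almost every crossing hyperplane. Written with distances, it
  does not refer to a base point.\<close>

definition energy :: "real ^ 'n \<Rightarrow> real ^ 'n \<Rightarrow> real" where
  "energy x y = (\<integral>H. indicator (crossing x y) H * (infdist x H + infdist y H) \<partial>\<nu>)"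

lemma integrable_energy:
  assumes "x \<in> \<Omega>" "y \<in> \<Omega>"
  shows "integrable \<nu> (\<lambda>H. indicator (crossing x y) H * (infdist x H + infdist y H))"
proof -
  have "integrable \<nu> (\<lambda>H. indicator (crossing x y) H *\<^sub>R (infdist x H + infdist y H))"
  proof (rule integrableI_bounded_set_indicator)
    show "emeasure \<nu> (crossing x y) < \<infinity>"
      using crossing_fmeasurable[OF assms] by (simp add: fmeasurable_def)
    have "norm (infdist x H + infdist y H) \<le> 2 * dist x y" if "H \<in> crossing x y" for H
      using infdist_le_dist_crossing[OF that] infdist_nonneg[of x H] infdist_nonneg[of y H] by simp
    then show "AE H in \<nu>. H \<in> crossing x y \<longrightarrow> norm (infdist x H + infdist y H) \<le> 2 * dist x y"
      by simp
  qed auto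
  then show ?thesis by simp
qed

definition monotone_map :: "real ^ 'n \<Rightarrow> real ^ 'n \<Rightarrow> real ^ 'n" where
  "monotone_map p x = (\<integral>H. indicator (crossing p x) H *\<^sub>R away_normal p H \<partial>\<nu>)"

lemma integrable_monotone_map:
  assumes "p \<in> \<Omega>" "x \<in> \<Omega>"
  shows "integrable \<nu> (\<lambda>H. indicator (crossing p x) H *\<^sub>R away_normal p H)"
  using crossing_fmeasurable[OF assms]
  by (intro integrableI_bounded_set_indicator[where B=1])
    (auto simp: fmeasurable_def norm_away_normal_le)

lemma monotone_map_diff:
  assumes "p \<in> \<Omega>" "x \<in> \<Omega>" "y \<in> \<Omega>"
  shows "monotone_map p x - monotone_map p y =
    (\<integral>H. (indicator (crossing p x) H - indicator (crossing p y) H) *\<^sub>R away_normal p H \<partial>\<nu>)"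
  unfolding monotone_map_def
  by (simp add: integrable_monotone_map assms scaleR_diff_left)

lemma integrable_monotone_map_diff:
  assumes "p \<in> \<Omega>" "x \<in> \<Omega>" "y \<in> \<Omega>"
  shows "integrable \<nu> (\<lambda>H. (indicator (crossing p x) H - indicator (crossing p y) H)
    *\<^sub>R away_normal p H)"
  by (simp add: integrable_monotone_map assms scaleR_diff_left)

lemma norm_monotone_map_diff_le:
  assumes "p \<in> \<Omega>" "x \<in> \<Omega>" "y \<in> \<Omega>"
  shows "norm (monotone_map p x - monotone_map p y) \<le> d x y"
proof -
  let ?f = "\<lambda>H. (indicator (crossing p x) H - indicator (crossing p y) H) *\<^sub>R away_normal p H"
  have "norm (monotone_map p x - monotone_map p y) \<le> (\<integral>H. norm (?f H) \<partial>\<nu>)"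
    unfolding monotone_map_diff[OF assms] by (rule integral_norm_bound)
  also have "\<dots> \<le> (\<integral>H. indicator (crossing x y) H \<partial>\<nu>)"
  proof (rule integral_mono_AE)
    show "integrable \<nu> (\<lambda>H. norm (?f H))"
      using integrable_monotone_map_diff[OF assms] by (rule integrable_norm)
    show "integrable \<nu> (indicator (crossing x y) :: _ \<Rightarrow> real)"
      using crossing_fmeasurable[OF assms(2,3)] by (simp add: fmeasurable_def)
    show "AE H in \<nu>. norm (?f H) \<le> indicator (crossing x y) H"
      using AE_notin[OF assms(1)] AE_notin[OF assms(2)] AE_notin[OF assms(3)] AE_in_hyperplanes
    proof eventually_elim
      case (elim H)
      have "norm (?f H) = indicator (crossing x y) H * norm (away_normal p H)"
        by (simp add: crossing_difference(1) elim)
      also have "\<dots> \<le> indicator (crossing x y) H * 1"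
        by (intro mult_left_mono norm_away_normal_le) simp
      finally show ?case by simp
    qed
  qed
  also have "\<dots> = d x y"
    by (simp add: busemann_dist_def)
  finally show ?thesis .
qed

lemma inner_monotone_map_diff:
  assumes "p \<in> \<Omega>" "x \<in> \<Omega>" "y \<in> \<Omega>"
  shows "(monotone_map p x - monotone_map p y) \<bullet> (x - y) = energy x y"
proof -
  let ?f = "\<lambda>H. (indicator (crossing p x) H - indicator (crossing p y) H) *\<^sub>R away_normal p H"
  have "(monotone_map p x - monotone_map p y) \<bullet> (x - y) = (\<integral>H. ?f H \<bullet> (x - y) \<partial>\<nu>)"
    unfolding monotone_map_diff[OF assms]
    by (intro integral_inner_left[symmetric] integrable_monotone_map_diff assms)
  also have "\<dots> = energy x y"
    unfolding energy_def
  proof (rule integral_cong_AE)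
    show "AE H in \<nu>. ?f H \<bullet> (x - y) = indicator (crossing x y) H * (infdist x H + infdist y H)"
      using AE_notin[OF assms(1)] AE_notin[OF assms(2)] AE_notin[OF assms(3)] AE_in_hyperplanes
    proof eventually_elim
      case (elim H)
      then show ?case
        using crossing_difference(2)[of H p x y] by simp
    qed
  qed measurable
  finally show ?thesis .
qed

end

section \<open>Local comparability\<close>

text \<open>Argued by contraposition: if \<open>d x b\<close> exceeded
  \<open>\<epsilon> * d x a\<close>, the argument of \<open>\<eta>\<close> would be at most
  \<open>1 / \<epsilon>\<close>, where \<open>\<eta>\<close> is bounded by some \<open>M\<close>,
  and \<open>x\<close> could not be that much closer to \<open>b\<close> than to \<open>a\<close>.
  Since \<open>\<eta>\<close> is the same everywhere, \<open>\<delta>\<close> does not depend on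
  \<open>p\<close>; only the radius does.\<close>

lemma (in admissible_measure) locally_quasisymmetric_comparable:
  assumes "qs_modulus \<eta>" and qs: "locally_quasisymmetric \<eta> \<Omega> d id" and \<epsilon>: "0 < \<epsilon>"
  shows "\<exists>\<delta>>0. \<forall>p\<in>\<Omega>. \<exists>r>0. ball p r \<subseteq> \<Omega> \<and>
    (\<forall>a\<in>ball p r. \<forall>b\<in>ball p r. \<forall>x\<in>ball p r.
      norm (x - b) \<le> \<delta> * norm (x - a) \<longrightarrow> d x b \<le> \<epsilon> * d x a)"
proof -
  interpret Metric_space \<Omega> d
    by (rule Metric_space_d)
  have "continuous_on {0..} \<eta>"
    using assms(1) by (auto simp: qs_modulus_def homeomorphism_def)
  then have "compact (\<eta> ` {0..1 / \<epsilon>})"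
    by (intro compact_continuous_image compact_Icc) (auto elim: continuous_on_subset)
  then obtain M where M: "0 < M" "\<And>t. 0 \<le> t \<Longrightarrow> t \<le> 1 / \<epsilon> \<Longrightarrow> \<bar>\<eta> t\<bar> \<le> M"
    using compact_imp_bounded[of "\<eta> ` {0..1 / \<epsilon>}"] unfolding bounded_pos by auto
  \<comment> \<open>\<open>M * \<delta> < 1\<close> yields the final contradiction, and
    \<open>\<delta> < 1\<close> excludes \<open>a = b\<close>.\<close>
  define \<delta> where "\<delta> = 1 / (M + 1)"
  have \<delta>: "0 < \<delta>" "\<delta> < 1" "M * \<delta> < 1"
    using M(1) by (auto simp: \<delta>_def field_simps)
  have "\<exists>r>0. ball p r \<subseteq> \<Omega> \<and> (\<forall>a\<in>ball p r. \<forall>b\<in>ball p r. \<forall>x\<in>ball p r.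
      norm (x - b) \<le> \<delta> * norm (x - a) \<longrightarrow> d x b \<le> \<epsilon> * d x a)" if p: "p \<in> \<Omega>" for p
  proof -
    obtain U V where UV: "openin mtopology V" "p \<in> V" "V \<subseteq> U" and "quasisymmetric \<eta> U d id"
      using bspec[OF qs[unfolded locally_quasisymmetric_def] p] by (elim exE conjE)
    then have q: "norm (x - a) \<le> \<eta> (d x a / d x b) * norm (x - b)"
      if "a \<in> U" "b \<in> U" "x \<in> U" "distinct [a, b, x]" for a b x
      using that by (auto simp: quasisymmetric_def)
    obtain e where "e > 0" "mball p e \<subseteq> V"
      using UV by (auto simp: openin_mtopology)
    \<comment> \<open>The quasisymmetry neighbourhood is open for \<open>d\<close>; continuity of
      \<open>d\<close> provides a Euclidean ball inside it.\<close>
    moreover obtain r where r: "0 < r" "ball p r \<subseteq> \<Omega>" "\<And>y. dist p y < r \<Longrightarrow> d p y < e"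
      using d_small[OF p \<open>e > 0\<close>] by blast
    ultimately have sub: "ball p r \<subseteq> U"
      using UV(3) p by (auto simp: in_mball subset_iff)
    have "d x b \<le> \<epsilon> * d x a"
      if mem: "a \<in> ball p r" "b \<in> ball p r" "x \<in> ball p r" and le: "norm (x - b) \<le> \<delta> * norm (x - a)" for a b x
    proof (rule ccontr)
      assume gt: "\<not> d x b \<le> \<epsilon> * d x a"
      have \<Omega>: "a \<in> \<Omega>" "b \<in> \<Omega>" "x \<in> \<Omega>"
        using mem r by auto
      have "x \<noteq> b"
      proof
        assume "x = b"
        then show False
          using gt \<epsilon> d_nonneg[of b a] d_self[OF \<Omega>(2)] by simp
      qed
      then have xa: "x \<noteq> a"
        using le by auto
      have "a \<noteq> b"
        using le xa \<delta>(2) by (auto simp: mult_le_cancel_right1)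
      have dpos: "d x b > 0"
        using d_pos \<Omega> \<open>x \<noteq> b\<close> by blast
      have "d x a / d x b \<le> 1 / \<epsilon>"
        using gt dpos \<epsilon> by (simp add: divide_simps mult.commute)
      then have "\<bar>\<eta> (d x a / d x b)\<bar> \<le> M"
        by (intro M) (simp_all add: d_nonneg)
      then have "\<eta> (d x a / d x b) * norm (x - b) \<le> M * norm (x - b)"
        by (intro mult_right_mono) auto
      moreover have "norm (x - a) \<le> \<eta> (d x a / d x b) * norm (x - b)"
        using mem sub \<open>x \<noteq> b\<close> \<open>a \<noteq> b\<close> xa by (intro q) auto
      ultimately have "norm (x - a) \<le> M * norm (x - b)"
        by linarith
      also have "\<dots> \<le> M * (\<delta> * norm (x - a))"
        using le M(1) by (intro mult_left_mono) auto
      also have "\<dots> = (M * \<delta>) * norm (x - a)"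
        by simp
      also have "\<dots> < 1 * norm (x - a)"
        using \<delta>(3) xa by (intro mult_strict_right_mono) auto
      finally show False by simp
    qed
    then show ?thesis
      using r by blast
  qed
  then show ?thesis
    using \<delta>(1) by blast
qed

text \<open>What is retained of quasisymmetry: a comparison of distances at small scales, with
  \<open>\<delta>\<close> uniform in \<open>p\<close>.\<close>

locale comparable_measure = admissible_measure \<Omega> \<nu>
  for \<Omega> :: "(real ^ 'n) set" and \<nu> :: "(real ^ 'n) set measure" +
  assumes comparable: "0 < \<epsilon> \<Longrightarrow> \<exists>\<delta>>0. \<forall>p\<in>\<Omega>. \<exists>r>0. ball p r \<subseteq> \<Omega> \<and>
    (\<forall>a\<in>ball p r. \<forall>b\<in>ball p r. \<forall>x\<in>ball p r.
      norm (x - b) \<le> \<delta> * norm (x - a) \<longrightarrow> d x b \<le> \<epsilon> * d x a)"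
begin

text \<open>Hyperplanes within \<open>\<rho> = \<theta> * norm (x - y)\<close> of \<open>x\<close>
  meet a small ball, whose measure is at most half of \<open>d x y\<close>. The other hyperplanes
  crossing \<open>[x, y]\<close> carry at least the remaining half, and each contributes at least
  \<open>\<rho>\<close> to the energy.\<close>

lemma local_energy_lower:
  "\<exists>c>0. \<forall>p\<in>\<Omega>. \<exists>r>0. \<forall>x\<in>ball p r. \<forall>y\<in>ball p r. c * norm (x - y) * d x y \<le> energy x y"
proof -
  define m where "m = real CARD('n)"
  have m: "m > 0"
    by (simp add: m_def)
  \<comment> \<open>The ball is covered by \<open>2 * m\<close> segments; at
    \<open>d x y / (4 * m)\<close> each, they add up to \<open>d x y / 2\<close>.\<close>
  obtain \<delta> where \<delta>: "0 < \<delta>" and loc: "\<forall>p\<in>\<Omega>. \<exists>r>0. ball p r \<subseteq> \<Omega> \<and>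
    (\<forall>a\<in>ball p r. \<forall>b\<in>ball p r. \<forall>x\<in>ball p r.
      norm (x - b) \<le> \<delta> * norm (x - a) \<longrightarrow> d x b \<le> (1 / (4 * m)) * d x a)"
    using comparable[of "1 / (4 * m)"] m by auto
  \<comment> \<open>Division by \<open>m\<close> offsets the factor \<open>n\<close> in the covering
    segments. The bound 1/2 keeps their endpoints in \<open>ball p r\<close>.\<close>
  define \<theta> where "\<theta> = min \<delta> (1 / 2) / m"
  have \<theta>: "\<theta> > 0" "m * \<theta> \<le> \<delta>" "m * \<theta> \<le> 1 / 2"
    using m \<delta> by (auto simp: \<theta>_def)
  show ?thesis
  proof (rule exI[of _ "\<theta> / 2"], rule conjI, use \<theta> in simp, rule ballI)
    fix p assume "p \<in> \<Omega>"
    then obtain r where r: "r > 0" "ball p r \<subseteq> \<Omega>"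
      and cmp: "\<And>a b x. a \<in> ball p r \<Longrightarrow> b \<in> ball p r \<Longrightarrow> x \<in> ball p r \<Longrightarrow>
         norm (x - b) \<le> \<delta> * norm (x - a) \<Longrightarrow> d x b \<le> (1 / (4 * m)) * d x a"
      using loc by meson
    have "\<theta> / 2 * norm (x - y) * d x y \<le> energy x y" if xy: "x \<in> ball p (r/2)" "y \<in> ball p (r/2)" for x y
    proof -
      define \<rho> where "\<rho> = \<theta> * norm (x - y)"
      have \<rho>: "0 \<le> \<rho>" "m * \<rho> \<le> \<delta> * norm (x - y)" "m * \<rho> \<le> norm (x - y) / 2"
        using \<theta> mult_right_mono[OF \<theta>(2), of "norm (x - y)"] mult_right_mono[OF \<theta>(3), of "norm (x - y)"]
        by (auto simp: \<rho>_def)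
      have xyr: "x \<in> ball p r" "y \<in> ball p r"
        using xy r by auto
      then have xy\<Omega>: "x \<in> \<Omega>" "y \<in> \<Omega>"
        using r by auto
      have "dist x y \<le> dist p x + dist p y"
        by (metis dist_commute dist_triangle)
      then have lt: "norm (x - y) < r"
        using xy by (simp add: dist_norm)
      have near: "x + v \<in> \<Omega> \<and> d x (x + v) \<le> 1 / (4 * m) * d x y" if "norm v = m * \<rho>" for v
      proof -
        have "dist p (x + v) \<le> dist p x + norm v"
          using norm_triangle_ineq4[of "p - x" v] by (simp add: dist_norm algebra_simps)
        also have "\<dots> < r"
          using xy(1) that \<rho>(3) lt by simp
        finally have "x + v \<in> ball p r" by simp
        moreover from this have "d x (x + v) \<le> 1 / (4 * m) * d x y"
          using \<rho>(2) that by (intro cmp xyr) auto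
        ultimately show ?thesis
          using r by auto
      qed
      let ?U = "\<lambda>i. crossing x (x + (m * \<rho>) *\<^sub>R axis i 1) \<union> crossing x (x - (m * \<rho>) *\<^sub>R axis i 1)"
      let ?C = "hyperplanes_meeting (cball x \<rho>)" and ?A = "crossing x y - hyperplanes_meeting (cball x \<rho>)"
      have mr: "m * \<rho> \<ge> 0" using \<rho>(1) m by simp
      have n1: "x + (m * \<rho>) *\<^sub>R axis i 1 \<in> \<Omega>" "d x (x + (m * \<rho>) *\<^sub>R axis i 1) \<le> 1 / (4 * m) * d x y"
        and n2: "x - (m * \<rho>) *\<^sub>R axis i 1 \<in> \<Omega>" "d x (x - (m * \<rho>) *\<^sub>R axis i 1) \<le> 1 / (4 * m) * d x y" for i :: 'n
        using near[of "(m * \<rho>) *\<^sub>R axis i 1"] near[of "- (m * \<rho>) *\<^sub>R axis i 1"] mr by auto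
      have Ufm: "?U i \<in> fmeasurable \<nu>" for i :: 'n
        by (intro fmeasurable.Un crossing_fmeasurable xy\<Omega> n1 n2)
      have UUfm: "(\<Union>i\<in>UNIV. ?U i) \<in> fmeasurable \<nu>"
        by (intro fmeasurable.finite_UN Ufm) auto
      have sub: "?C \<subseteq> (\<Union>i\<in>UNIV. ?U i)"
        using hyperplanes_meeting_cball_subset[OF \<rho>(1), of x] by (simp add: m_def)
      have "measure \<nu> ?C \<le> measure \<nu> (\<Union>i\<in>UNIV. ?U i)"
        using sub by (intro measure_mono_fmeasurable UUfm) auto
      also have "\<dots> \<le> (\<Sum>i\<in>UNIV. measure \<nu> (?U i))"
        by (intro measure_UNION_le) auto
      also have "\<dots> \<le> (\<Sum>i\<in>(UNIV::'n set). 1 / (4 * m) * d x y + 1 / (4 * m) * d x y)"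
      proof (rule sum_mono)
        fix i :: 'n
        have "measure \<nu> (?U i) \<le> d x (x + (m * \<rho>) *\<^sub>R axis i 1) + d x (x - (m * \<rho>) *\<^sub>R axis i 1)"
          unfolding busemann_dist_def by (intro measure_Un_le) auto
        then show "measure \<nu> (?U i) \<le> 1 / (4 * m) * d x y + 1 / (4 * m) * d x y"
          using n1(2)[of i] n2(2)[of i] by linarith
      qed
      also have "\<dots> = d x y / 2"
        using m by (simp add: m_def)
      finally have C: "measure \<nu> ?C \<le> d x y / 2" .
      have Cfm: "?C \<in> fmeasurable \<nu>"
        by (rule fmeasurableI2[OF UUfm sub]) simp
      have Afm: "?A \<in> fmeasurable \<nu>"
        by (intro fmeasurable.Diff crossing_fmeasurable xy\<Omega> Cfm)
      have "d x y \<le> measure \<nu> (?A \<union> ?C)"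
        unfolding busemann_dist_def
        by (intro measure_mono_fmeasurable fmeasurable.Un Afm Cfm) auto
      also have "\<dots> \<le> measure \<nu> ?A + measure \<nu> ?C"
        by (intro measure_Un_le) auto
      finally have A: "d x y / 2 \<le> measure \<nu> ?A"
        using C by linarith
      have "\<theta> / 2 * norm (x - y) * d x y = \<rho> * (d x y / 2)"
        by (simp add: \<rho>_def)
      also have "\<dots> \<le> \<rho> * measure \<nu> ?A"
        using A \<rho>(1) by (rule mult_left_mono)
      also have "\<dots> = \<rho> * measure \<nu> (?A \<inter> space \<nu>)"
        by (rule arg_cong[of _ _ "\<lambda>X. \<rho> * measure \<nu> X"]) (auto simp: hyperplanes_meeting_def)
      also have "\<dots> = (\<integral>H. \<rho> * indicator ?A H \<partial>\<nu>)"
        by simp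
      also have "\<dots> \<le> energy x y"
        unfolding energy_def
      proof (rule integral_mono)
        show "integrable \<nu> (\<lambda>H. \<rho> * indicator ?A H)"
          using Afm by (simp add: fmeasurable_def)
        show "integrable \<nu> (\<lambda>H. indicator (crossing x y) H * (infdist x H + infdist y H))"
          by (intro integrable_energy xy\<Omega>)
        fix H assume "H \<in> space \<nu>"
        then have "H \<notin> ?C \<Longrightarrow> \<rho> \<le> infdist x H"
          using mem_hyperplanes_meeting_cball_iff[of H x \<rho>] by auto
        then show "\<rho> * indicator ?A H \<le> indicator (crossing x y) H * (infdist x H + infdist y H)"
          using infdist_nonneg[of x H] infdist_nonneg[of y H] by (auto simp: indicator_def)
      qed
      finally show ?thesis .
    qed
    then show "\<exists>r>0. \<forall>x\<in>ball p r. \<forall>y\<in>ball p r. \<theta> / 2 * norm (x - y) * d x y \<le> energy x y"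
      using r by (intro exI[of _ "r/2"]) auto
  qed
qed

text \<open>Along a segment, increments of the monotone map paired with the fixed direction
  \<open>y - x\<close> are additive, while \<open>d\<close> is subadditive. The local inequality
  therefore survives concatenation, and a bisection argument carries it to the whole
  segment.\<close>

lemma energy_lower:
  obtains c where "0 < c" "\<And>x y. x \<in> \<Omega> \<Longrightarrow> y \<in> \<Omega> \<Longrightarrow> c * norm (x - y) * d x y \<le> energy x y"
proof -
  obtain c where c: "c > 0" and loc: "\<And>p. p \<in> \<Omega> \<Longrightarrow>
      \<exists>r>0. \<forall>x\<in>ball p r. \<forall>y\<in>ball p r. c * norm (x - y) * d x y \<le> energy x y"
    using local_energy_lower by auto
  have "c * norm (x - y) * d x y \<le> energy x y" if xy: "x \<in> \<Omega>" "y \<in> \<Omega>" for x y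
  proof -
    define F where "F = monotone_map x"
    define \<gamma> where "\<gamma> s = x + s *\<^sub>R (y - x)" for s
    \<comment> \<open>The guards are needed because the local condition of \<open>Bolzano\<close>
      also admits parameters outside \<open>[0, 1]\<close>, where the point may leave the
      domain.\<close>
    define P where "P s t \<longleftrightarrow> (0 \<le> s \<longrightarrow> t \<le> 1 \<longrightarrow>
      c * norm (y - x) * d (\<gamma> s) (\<gamma> t) \<le> (F (\<gamma> t) - F (\<gamma> s)) \<bullet> (y - x))" for s t
    have \<gamma>\<Omega>: "\<gamma> s \<in> \<Omega>" if "0 \<le> s" "s \<le> 1" for s
    proof -
      have "\<gamma> s = (1 - s) *\<^sub>R x + s *\<^sub>R y"
        by (simp add: \<gamma>_def algebra_simps)
      then show ?thesis
        using convexD_alt[OF convex xy] that by simp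
    qed
    have "P 0 1"
    proof (rule Bolzano)
      show "(0::real) \<le> 1" by simp
      fix s t u assume st: "P s t" "P t u" "s \<le> t" "t \<le> u"
      show "P s u"
        unfolding P_def
      proof (intro impI)
        assume "0 \<le> s" "u \<le> 1"
        then have "d (\<gamma> s) (\<gamma> u) \<le> d (\<gamma> s) (\<gamma> t) + d (\<gamma> t) (\<gamma> u)"
          using st by (intro d_triangle \<gamma>\<Omega>) auto
        then have "c * norm (y - x) * d (\<gamma> s) (\<gamma> u) \<le>
            c * norm (y - x) * (d (\<gamma> s) (\<gamma> t) + d (\<gamma> t) (\<gamma> u))"
          using c by (intro mult_left_mono) auto
        also have "\<dots> \<le> (F (\<gamma> t) - F (\<gamma> s)) \<bullet> (y - x) + (F (\<gamma> u) - F (\<gamma> t)) \<bullet> (y - x)"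
          using st \<open>0 \<le> s\<close> \<open>u \<le> 1\<close> by (auto simp: P_def distrib_left)
        finally show "c * norm (y - x) * d (\<gamma> s) (\<gamma> u) \<le> (F (\<gamma> u) - F (\<gamma> s)) \<bullet> (y - x)"
          by (simp add: inner_diff_left)
      qed
    next
      fix w :: real assume w: "0 \<le> w" "w \<le> 1"
      then obtain r where r: "r > 0"
        and low: "\<And>a b. a \<in> ball (\<gamma> w) r \<Longrightarrow> b \<in> ball (\<gamma> w) r \<Longrightarrow> c * norm (a - b) * d a b \<le> energy a b"
        using loc[OF \<gamma>\<Omega>] by blast
      define \<delta> where "\<delta> = r / (norm (y - x) + 1)"
      have \<delta>: "\<delta> > 0" "\<delta> * norm (y - x) < r"
        using r by (auto simp: \<delta>_def field_simps add_pos_nonneg)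
      have "P s t" if st: "s \<le> w \<and> w \<le> t \<and> t - s < \<delta>" for s t
        unfolding P_def
      proof (intro impI)
        assume bd: "0 \<le> s" "t \<le> 1"
        have near: "\<gamma> q \<in> ball (\<gamma> w) r" if "\<bar>q - w\<bar> < \<delta>" for q
        proof -
          have "dist (\<gamma> w) (\<gamma> q) = \<bar>q - w\<bar> * norm (y - x)"
            by (simp add: \<gamma>_def dist_norm flip: scaleR_diff_left) (simp add: abs_minus_commute)
          also have "\<dots> \<le> \<delta> * norm (y - x)"
            using that by (intro mult_right_mono) auto
          finally show ?thesis using \<delta> by simp
        qed
        have diff: "\<gamma> t - \<gamma> s = (t - s) *\<^sub>R (y - x)"
          by (simp add: \<gamma>_def algebra_simps)
        have *: "c * norm (\<gamma> t - \<gamma> s) * d (\<gamma> t) (\<gamma> s) \<le> energy (\<gamma> t) (\<gamma> s)"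
          using st by (intro low near) auto
        show "c * norm (y - x) * d (\<gamma> s) (\<gamma> t) \<le> (F (\<gamma> t) - F (\<gamma> s)) \<bullet> (y - x)"
        proof (cases "s = t")
          case True
          then show ?thesis
            using d_self[OF \<gamma>\<Omega>, of t] bd st by simp
        next
          case False
          have "energy (\<gamma> t) (\<gamma> s) = (F (\<gamma> t) - F (\<gamma> s)) \<bullet> (\<gamma> t - \<gamma> s)"
            unfolding F_def using bd st xy by (intro inner_monotone_map_diff[symmetric] \<gamma>\<Omega>) auto
          with * False st have "(t - s) * (c * norm (y - x) * d (\<gamma> s) (\<gamma> t))
              \<le> (t - s) * ((F (\<gamma> t) - F (\<gamma> s)) \<bullet> (y - x))"
            unfolding diff by (simp add: mult_ac d_commute[of "\<gamma> t"])
          then show ?thesis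
            using False st by simp
        qed
      qed
      then show "\<exists>\<delta>>0. \<forall>s t. s \<le> w \<and> w \<le> t \<and> t - s < \<delta> \<longrightarrow> P s t"
        using \<delta> by blast
    qed
    then have "c * norm (y - x) * d x y \<le> (F y - F x) \<bullet> (y - x)"
      by (simp add: P_def \<gamma>_def)
    also have "\<dots> = energy y x"
      unfolding F_def using xy by (intro inner_monotone_map_diff)
    also have "\<dots> = energy x y"
      by (simp add: energy_def closed_segment_commute add.commute)
    finally show ?thesis
      by (simp add: norm_minus_commute)
  qed
  then show thesis
    using that c by blast
qed

section \<open>The monotone map as a bi-Lipschitz embedding\<close>

text \<open>Cauchy-Schwarz bounds the energy by \<open>norm (x - y)\<close> times the displacement
  of the map; cancelling \<open>norm (x - y)\<close> in the energy bound leaves the claim, with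
  \<open>c\<close> independent of \<open>p\<close>.\<close>

lemma monotone_map_lower:
  obtains c where "0 < c"
    "\<And>p x y. p \<in> \<Omega> \<Longrightarrow> x \<in> \<Omega> \<Longrightarrow> y \<in> \<Omega> \<Longrightarrow>
      c * d x y \<le> norm (monotone_map p x - monotone_map p y)"
proof -
  obtain c where c: "0 < c"
    and low: "\<And>x y. x \<in> \<Omega> \<Longrightarrow> y \<in> \<Omega> \<Longrightarrow> c * norm (x - y) * d x y \<le> energy x y"
    using energy_lower by blast
  have "c * d x y \<le> norm (monotone_map p x - monotone_map p y)"
    if "p \<in> \<Omega>" "x \<in> \<Omega>" "y \<in> \<Omega>" for p x y
  proof (cases "x = y")
    case True
    then show ?thesis using that by (simp add: d_self)
  next
    case False
    have "norm (x - y) * (c * d x y) \<le> energy x y"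
      using low[of x y] that by (simp add: mult_ac)
    also have "\<dots> \<le> norm (x - y) * norm (monotone_map p x - monotone_map p y)"
      using that norm_cauchy_schwarz[of "monotone_map p x - monotone_map p y" "x - y"]
      by (simp add: mult.commute flip: inner_monotone_map_diff[of p])
    finally show ?thesis
      using False by simp
  qed
  then show thesis
    using that c by blast
qed

lemma continuous_on_monotone_map:
  assumes "p \<in> \<Omega>"
  shows "continuous_on \<Omega> (monotone_map p)"
  unfolding continuous_on_iff
proof (intro ballI allI impI)
  fix e :: real and x :: "real ^ 'n" assume "x \<in> \<Omega>" "0 < e"
  then obtain \<delta> where "0 < \<delta>" and \<delta>: "\<And>y. dist x y < \<delta> \<Longrightarrow> d x y < e"
    using d_small by metis
  moreover have "dist (monotone_map p y) (monotone_map p x) < e" if "y \<in> \<Omega>" "dist y x < \<delta>" for y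
    using norm_monotone_map_diff_le[OF assms \<open>y \<in> \<Omega>\<close> \<open>x \<in> \<Omega>\<close>] \<delta>[of y] that
    by (simp add: dist_norm d_commute[of y] dist_commute[of y] norm_minus_commute)
  ultimately show "\<exists>\<delta>>0. \<forall>y\<in>\<Omega>. dist y x < \<delta> \<longrightarrow> dist (monotone_map p y) (monotone_map p x) < e"
    by blast
qed

lemma monotone_map_image:
  assumes "p \<in> \<Omega>"
  shows "is_domain (monotone_map p ` \<Omega>)"
    and "bilipschitz_equivalent \<Omega> d (monotone_map p ` \<Omega>) dist"
proof -
  obtain c where c: "0 < c" and low: "\<And>x y. x \<in> \<Omega> \<Longrightarrow> y \<in> \<Omega> \<Longrightarrow>
      c * d x y \<le> norm (monotone_map p x - monotone_map p y)"
    using monotone_map_lower assms by metis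
  have inj: "inj_on (monotone_map p) \<Omega>"
  proof (rule inj_onI, rule ccontr)
    fix x y assume xy: "x \<in> \<Omega>" "y \<in> \<Omega>" "monotone_map p x = monotone_map p y" "x \<noteq> y"
    then show False
      using low[of x y] d_pos[of x y] c by (simp add: mult_le_0_iff)
  qed
  show "is_domain (monotone_map p ` \<Omega>)"
    using assms convex
    by (auto simp: is_domain_def convex_connected inj open_dom
        intro!: connected_continuous_image continuous_on_monotone_map invariance_of_domain)
  show "bilipschitz_equivalent \<Omega> d (monotone_map p ` \<Omega>) dist"
    unfolding bilipschitz_equivalent_def
  proof (intro exI conjI ballI)
    show "bij_betw (monotone_map p) \<Omega> (monotone_map p ` \<Omega>)"
      using inj by (rule inj_on_imp_bij_betw)
    let ?L = "max 1 (inverse c)"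
    show "?L \<ge> 1" by simp
    fix x y assume xy: "x \<in> \<Omega>" "y \<in> \<Omega>"
    have "inverse ?L \<le> c"
      using c by (simp add: max_def le_imp_inverse_le field_simps)
    then have "inverse ?L * d x y \<le> c * d x y"
      by (intro mult_right_mono d_nonneg)
    also have "\<dots> \<le> dist (monotone_map p x) (monotone_map p y)"
      using low xy by (simp add: dist_norm)
    finally show "inverse ?L * d x y \<le> dist (monotone_map p x) (monotone_map p y)" .
    have "dist (monotone_map p x) (monotone_map p y) \<le> 1 * d x y"
      using norm_monotone_map_diff_le[OF assms xy] by (simp add: dist_norm)
    also have "\<dots> \<le> ?L * d x y"
      by (intro mult_right_mono d_nonneg) simp
    finally show "dist (monotone_map p x) (monotone_map p y) \<le> ?L * d x y" .
  qed
qed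

end

section \<open>Second differences of the distance to a hyperplane\<close>

definition second_diff :: "('a::real_normed_vector) set \<Rightarrow> 'a \<Rightarrow> 'a \<Rightarrow> real" where
  "second_diff H x p = infdist (x + p) H + infdist (x - p) H - 2 * infdist x H"

text \<open>With \<open>a\<close> the signed distance of \<open>x\<close> and \<open>b\<close> the
  normal component of \<open>p\<close>, the second difference is
  \<open>2 * max 0 (\<bar>b\<bar> - \<bar>a\<bar>)\<close>. It vanishes unless \<open>H\<close>
  crosses the full segment. Crossing the half-length segment means
  \<open>2 * \<bar>a\<bar> \<le> \<bar>b\<bar>\<close>; then the two distances add up to
  \<open>\<bar>b\<bar>\<close>, which is at most the second difference.\<close>

lemma second_diff_bounds:
  fixes H :: "(real ^ 'n) set"
  assumes "H \<in> hyperplanes"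
  shows "0 \<le> second_diff H x p"
    and "second_diff H x p \<le> indicator (hyperplanes_meeting (closed_segment (x - p) (x + p))) H * (2 * norm p)"
    and "indicator (hyperplanes_meeting (closed_segment (x - p /\<^sub>R 2) (x + p /\<^sub>R 2))) H *
        (infdist (x - p /\<^sub>R 2) H + infdist (x + p /\<^sub>R 2) H) \<le> second_diff H x p"
proof -
  obtain u t where u: "norm u = 1" and H: "H = {x. u \<bullet> x = t}"
    using assms by (rule hyperplanesE)
  note iff = mem_hyperplanes_meeting_segment_iff[OF assms H]
  define a b where "a = u \<bullet> x - t" and "b = u \<bullet> p"
  have d: "infdist z H = \<bar>u \<bullet> z - t\<bar>" for z
    unfolding H by (rule infdist_hyperplane[OF u])
  have s: "second_diff H x p = \<bar>a + b\<bar> + \<bar>a - b\<bar> - 2 * \<bar>a\<bar>"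
    by (simp add: second_diff_def d a_def b_def inner_simps algebra_simps)
  have ab: "u \<bullet> (x + p) - t = a + b" "u \<bullet> (x - p) - t = a - b"
    "u \<bullet> (x + p /\<^sub>R 2) - t = a + b / 2" "u \<bullet> (x - p /\<^sub>R 2) - t = a - b / 2"
    by (simp_all add: a_def b_def inner_simps)
  show "0 \<le> second_diff H x p"
    unfolding s by linarith
  have "\<bar>b\<bar> \<le> norm p"
    using Cauchy_Schwarz_ineq2[of u p] u by (simp add: b_def)
  then show "second_diff H x p \<le>
      indicator (hyperplanes_meeting (closed_segment (x - p) (x + p))) H * (2 * norm p)"
    unfolding s indicator_def iff ab mult_le_0_iff by (auto simp: abs_if split: if_splits)
  show "indicator (hyperplanes_meeting (closed_segment (x - p /\<^sub>R 2) (x + p /\<^sub>R 2))) H *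
      (infdist (x - p /\<^sub>R 2) H + infdist (x + p /\<^sub>R 2) H) \<le> second_diff H x p"
    unfolding s indicator_def iff ab d mult_le_0_iff by (auto simp: abs_if split: if_splits)
qed

lemma centre_in_segment: "x \<in> closed_segment (x - h) (x + h :: 'a::real_vector)"
  unfolding in_segment
  by (intro exI[of _ "1/2 :: real"]) (simp add: scaleR_diff_right scaleR_add_right flip: scaleR_add_left)

locale global_comparable_measure = comparable_measure UNIV \<nu>
  for \<nu> :: "(real ^ 'n) set measure"
begin

text \<open>Formally the second difference of the convex potential obtained by integrating
  \<open>infdist x H\<close> over all \<open>H\<close>. That integral may diverge; the integral of
  second differences is finite because only crossing hyperplanes contribute.\<close>

definition bend :: "real ^ 'n \<Rightarrow> real ^ 'n \<Rightarrow> real" where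
  "bend x p = (\<integral>H. second_diff H x p \<partial>\<nu>)"

lemma integrable_second_diff: "integrable \<nu> (\<lambda>H. second_diff H x p)"
proof (rule Bochner_Integration.integrable_bound)
  show "integrable \<nu> (\<lambda>H. indicator (crossing (x - p) (x + p)) H * (2 * norm p))"
    using crossing_fmeasurable[of "x - p" "x + p"]
    by (intro integrable_mult_left) (simp add: fmeasurable_def)
  show "(\<lambda>H. second_diff H x p) \<in> borel_measurable \<nu>"
    unfolding second_diff_def by measurable
  show "AE H in \<nu>. norm (second_diff H x p) \<le>
      norm (indicator (crossing (x - p) (x + p)) H * (2 * norm p))"
    using AE_in_hyperplanes
  proof eventually_elim
    case (elim H)
    show ?case
      using second_diff_bounds(1,2)[OF elim, of x p] by simp
  qed
qed

text \<open>With \<open>energy_le_bend\<close> and \<open>energy_lower\<close>, this traps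
  \<open>bend x p\<close> between multiples of \<open>norm p\<close> times the
  \<open>d\<close>-length of the segment centred at \<open>x\<close>, taken at half scale below and
  at full scale above.\<close>

lemma bend_le: "bend x p \<le> 2 * norm p * d (x - p) (x + p)"
proof -
  have "bend x p \<le> (\<integral>H. indicator (crossing (x - p) (x + p)) H * (2 * norm p) \<partial>\<nu>)"
    unfolding bend_def
  proof (rule integral_mono)
    show "integrable \<nu> (\<lambda>H. indicator (crossing (x - p) (x + p)) H * (2 * norm p))"
      using crossing_fmeasurable[of "x - p" "x + p"]
      by (intro integrable_mult_left) (simp add: fmeasurable_def)
  qed (use second_diff_bounds(2) integrable_second_diff in auto)
  then show ?thesis
    by (simp add: busemann_dist_def mult_ac)
qed

lemma energy_le_bend: "energy (x - p /\<^sub>R 2) (x + p /\<^sub>R 2) \<le> bend x p"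
  unfolding bend_def energy_def
  by (rule integral_mono) (use second_diff_bounds(3) integrable_second_diff integrable_energy in auto)

text \<open>The second difference over the parallelogram with vertex \<open>b\<close> and edges \<open>2\<alpha>\<close>, \<open>2\<beta>\<close>: unlike
  \<^term>\<open>bend\<close> itself it is additive under cutting the parallelogram into four.\<close>

definition par :: "real ^ 'n \<Rightarrow> real ^ 'n \<Rightarrow> real ^ 'n \<Rightarrow> real" where
  "par b \<alpha> \<beta> = bend (b + \<alpha> + \<beta>) (\<alpha> + \<beta>) - bend (b + \<alpha> + \<beta>) (\<alpha> - \<beta>)"

text \<open>The alternating sum over the four vertices is integrable as a whole, though its single
  terms need not be; hence one statement about the combined integrand.\<close>

lemma has_bochner_integral_par:
  "has_bochner_integral \<nu> (\<lambda>H. infdist b H + infdist (b + 2 *\<^sub>R (\<alpha> + \<beta>)) H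
     - infdist (b + 2 *\<^sub>R \<alpha>) H - infdist (b + 2 *\<^sub>R \<beta>) H) (par b \<alpha> \<beta>)"
proof -
  have "has_bochner_integral \<nu>
      (\<lambda>H. second_diff H (b + \<alpha> + \<beta>) (\<alpha> + \<beta>) - second_diff H (b + \<alpha> + \<beta>) (\<alpha> - \<beta>)) (par b \<alpha> \<beta>)"
    unfolding par_def bend_def
    by (intro has_bochner_integral_diff has_bochner_integral_integrable integrable_second_diff)
  moreover have "b + \<alpha> + \<beta> + (\<alpha> + \<beta>) = b + 2 *\<^sub>R (\<alpha> + \<beta>)" "b + \<alpha> + \<beta> - (\<alpha> + \<beta>) = b"
    "b + \<alpha> + \<beta> + (\<alpha> - \<beta>) = b + 2 *\<^sub>R \<alpha>" "b + \<alpha> + \<beta> - (\<alpha> - \<beta>) = b + 2 *\<^sub>R \<beta>"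
    by (simp_all add: scaleR_2)
  ultimately show ?thesis
    by (simp add: second_diff_def algebra_simps)
qed

text \<open>In the alternating sums over the four pieces, only the four outer corners of the 3 by 3
  vertex grid survive, already pointwise in \<open>H\<close>.\<close>

lemma par_bisect:
  "par b (2 *\<^sub>R \<alpha>) (2 *\<^sub>R \<beta>) = par b \<alpha> \<beta> + par (b + 2 *\<^sub>R \<alpha>) \<alpha> \<beta> + par (b + 2 *\<^sub>R \<beta>) \<alpha> \<beta>
    + par (b + 2 *\<^sub>R \<alpha> + 2 *\<^sub>R \<beta>) \<alpha> \<beta>"
proof -
  \<comment> \<open>Brings shared grid points into one form so that they cancel.\<close>
  have vertices: "b + 2 *\<^sub>R (2 *\<^sub>R \<alpha> + 2 *\<^sub>R \<beta>) = b + 2 *\<^sub>R \<alpha> + 2 *\<^sub>R \<beta> + 2 *\<^sub>R (\<alpha> + \<beta>)"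
    "b + 2 *\<^sub>R 2 *\<^sub>R \<alpha> = b + 2 *\<^sub>R \<alpha> + 2 *\<^sub>R \<alpha>" "b + 2 *\<^sub>R 2 *\<^sub>R \<beta> = b + 2 *\<^sub>R \<beta> + 2 *\<^sub>R \<beta>"
    "b + 2 *\<^sub>R \<alpha> + 2 *\<^sub>R (\<alpha> + \<beta>) = b + 2 *\<^sub>R \<alpha> + 2 *\<^sub>R \<beta> + 2 *\<^sub>R \<alpha>"
    "b + 2 *\<^sub>R \<beta> + 2 *\<^sub>R (\<alpha> + \<beta>) = b + 2 *\<^sub>R \<alpha> + 2 *\<^sub>R \<beta> + 2 *\<^sub>R \<beta>"
    "b + 2 *\<^sub>R \<beta> + 2 *\<^sub>R \<alpha> = b + 2 *\<^sub>R \<alpha> + 2 *\<^sub>R \<beta>" "b + 2 *\<^sub>R (\<alpha> + \<beta>) = b + 2 *\<^sub>R \<alpha> + 2 *\<^sub>R \<beta>"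
    by (simp_all only: scaleR_2 scaleR_add_right add_ac)
  have "has_bochner_integral \<nu> (\<lambda>H. infdist b H + infdist (b + 2 *\<^sub>R (2 *\<^sub>R \<alpha> + 2 *\<^sub>R \<beta>)) H
     - infdist (b + 2 *\<^sub>R (2 *\<^sub>R \<alpha>)) H - infdist (b + 2 *\<^sub>R (2 *\<^sub>R \<beta>)) H)
    (par b \<alpha> \<beta> + par (b + 2 *\<^sub>R \<alpha>) \<alpha> \<beta> + par (b + 2 *\<^sub>R \<beta>) \<alpha> \<beta>
      + par (b + 2 *\<^sub>R \<alpha> + 2 *\<^sub>R \<beta>) \<alpha> \<beta>)"
    by (rule has_bochner_integral_cong[OF refl _ refl, THEN iffD1,
          OF _ has_bochner_integral_add[OF has_bochner_integral_add[OF has_bochner_integral_add[OF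
            has_bochner_integral_par has_bochner_integral_par] has_bochner_integral_par]
              has_bochner_integral_par]])
      (simp only: vertices)
  then show ?thesis
    using has_bochner_integral_eq[OF has_bochner_integral_par] by blast
qed

text \<open>Let \<open>D\<close> be the \<open>d\<close>-length of the middle half of
  \<open>[x - p, x + p]\<close>. Then \<open>bend x p \<ge> c * norm p * D\<close>, while for short
  \<open>q\<close> comparability gives \<open>bend x q \<le> 4 * norm q * D\<close>.\<close>

lemma local_bend_le:
  obtains k where "0 < k" "k \<le> 1"
    "\<And>z. \<exists>r>0. \<forall>x p q. cball x (norm p) \<subseteq> ball z r \<longrightarrow> norm q \<le> k * norm p \<longrightarrow> bend x q \<le> bend x p"
proof -
  obtain c where c: "0 < c" and low: "\<And>x y. c * norm (x - y) * d x y \<le> energy x y"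
    using energy_lower by auto
  obtain \<delta> where \<delta>: "0 < \<delta>" and loc: "\<And>z. \<exists>r>0. \<forall>a\<in>ball z r. \<forall>b\<in>ball z r. \<forall>x\<in>ball z r.
      norm (x - b) \<le> \<delta> * norm (x - a) \<longrightarrow> d x b \<le> d x a"
    using comparable[of 1] by auto
  \<comment> \<open>The bound \<open>\<delta> / 2\<close> permits comparison with
    \<open>p / 2\<close>, \<open>c / 4\<close> absorbs the factor 4 in the upper bound, and 1 keeps
    \<open>x + q\<close> and \<open>x - q\<close> in the ball.\<close>
  define k where "k = min 1 (min (\<delta> / 2) (c / 4))"
  have k: "0 < k" "k \<le> 1" "k \<le> \<delta> / 2" "k \<le> c / 4"
    using c \<delta> by (auto simp: k_def)
  show thesis
  proof (rule that[OF k(1,2)])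
    fix z
    obtain r where r: "0 < r" and cmp: "\<And>a b x. a \<in> ball z r \<Longrightarrow> b \<in> ball z r \<Longrightarrow> x \<in> ball z r \<Longrightarrow>
      norm (x - b) \<le> \<delta> * norm (x - a) \<Longrightarrow> d x b \<le> d x a"
      using loc[of z] by blast
    have "bend x q \<le> bend x p" if sub: "cball x (norm p) \<subseteq> ball z r" and q: "norm q \<le> k * norm p" for x p q
    proof -
      have qb: "norm q \<le> norm p" "norm q \<le> \<delta> / 2 * norm p" "norm q \<le> c / 4 * norm p"
        using order_trans[OF q mult_right_mono[OF k(2)]] order_trans[OF q mult_right_mono[OF k(3)]]
          order_trans[OF q mult_right_mono[OF k(4)]] by auto
      define h where "h = p /\<^sub>R 2"
      have h: "norm h = norm p / 2"
        by (simp add: h_def)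
      define D where "D = d (x - h) (x + h)"
      have mem: "x \<in> ball z r" "x + h \<in> ball z r" "x + q \<in> ball z r" "x - q \<in> ball z r"
        by (rule subsetD[OF sub], use qb(1) h norm_ge_zero[of p] in \<open>simp add: dist_norm del: norm_ge_zero\<close>)+
      have "d x (x + q) \<le> d x (x + h)" "d x (x - q) \<le> d x (x + h)"
        by (rule cmp[OF mem(2) mem(3) mem(1)], use qb(2) in \<open>simp add: h\<close>)
          (rule cmp[OF mem(2) mem(4) mem(1)], use qb(2) in \<open>simp add: h\<close>)
      moreover have "d x (x + h) \<le> D"
        using d_add[OF _ _ centre_in_segment, of x h] d_nonneg[of "x - h" x] by (simp add: D_def)
      moreover have "d (x - q) (x + q) \<le> d (x - q) x + d x (x + q)"
        by (intro d_triangle) auto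
      ultimately have qD: "d (x - q) (x + q) \<le> 2 * D"
        by (simp add: d_commute[of "x - q" x])
      have "bend x q \<le> 2 * norm q * d (x - q) (x + q)"
        by (rule bend_le)
      also have "\<dots> \<le> 2 * norm q * (2 * D)"
        using qD by (intro mult_left_mono) auto
      also have "\<dots> \<le> c * norm p * D"
        using mult_right_mono[OF qb(3), of D] by (simp add: D_def d_nonneg)
      also have "(x - h) - (x + h) = - (2 *\<^sub>R h)"
        by (simp add: scaleR_2)
      then have "norm p = norm ((x - h) - (x + h))"
        using h by simp
      also have "c * norm ((x - h) - (x + h)) * D \<le> energy (x - h) (x + h)"
        unfolding D_def by (rule low)
      also have "\<dots> \<le> bend x p"
        unfolding h_def by (rule energy_le_bend)
      finally show ?thesis .
    qed
    then show "\<exists>r>0. \<forall>x p q. cball x (norm p) \<subseteq> ball z r \<longrightarrow> norm q \<le> k * norm p \<longrightarrow> bend x q \<le> bend x p"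
      using r by blast
  qed
qed

text \<open>Bisecting parallelograms turns the local inequality into a global one, as for the wave
  inequality \<open>k\<^sup>2 \<partial>\<^sub>q\<^sup>2 u \<le> \<partial>\<^sub>p\<^sup>2 u\<close> on characteristic parallelograms.\<close>

lemma global_bend_le:
  obtains k where "0 < k" "k \<le> 1" "\<And>x p q. norm q \<le> k * norm p \<Longrightarrow> bend x q \<le> bend x p"
proof -
  obtain k where k: "0 < k" "k \<le> 1"
    and loc: "\<And>z. \<exists>r>0. \<forall>x p q. cball x (norm p) \<subseteq> ball z r \<longrightarrow> norm q \<le> k * norm p \<longrightarrow> bend x q \<le> bend x p"
    using local_bend_le by blast
  obtain r where r: "\<And>z. r z > 0"
    and loc: "\<And>z x p q. cball x (norm p) \<subseteq> ball z (r z) \<Longrightarrow> norm q \<le> k * norm p \<Longrightarrow> bend x q \<le> bend x p"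
    using loc by metis
  have "bend x q \<le> bend x p" if q: "norm q \<le> k * norm p" for x p q
  proof -
    \<comment> \<open>The parallelogram centred at \<open>x\<close> with half-diagonals
      \<open>p\<close> and \<open>q\<close>; the claim says that its \<open>par\<close> is
      nonnegative.\<close>
    define \<alpha> \<beta> where "\<alpha> = (p + q) /\<^sub>R 2" and "\<beta> = (p - q) /\<^sub>R 2"
    have pq: "\<alpha> + \<beta> = p" "\<alpha> - \<beta> = q"
      by (simp_all add: \<alpha>_def \<beta>_def algebra_simps flip: scaleR_2)
    define R where "R = norm p + 2 * norm \<alpha> + 2 * norm \<beta>"
    \<comment> \<open>A Lebesgue number for the cover by the balls of the local inequality. The
      radius \<open>R\<close> bounds the starting vertex plus both edges, a bound that every
      subdivision preserves.\<close>
    obtain \<epsilon> where \<epsilon>: "0 < \<epsilon>" and leb: "\<And>b. b \<in> cball x R \<Longrightarrow> \<exists>z. ball b \<epsilon> \<subseteq> ball z (r z)"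
    proof (rule Heine_Borel_lemma[OF compact_cball, of x R "range (\<lambda>z. ball z (r z))"])
      show "cball x R \<subseteq> (\<Union>z. ball z (r z))"
        using r by (auto intro: centre_in_ball[THEN iffD2])
    qed auto
    \<comment> \<open>At scale at most \<open>s0\<close>, the ball around the centre
      \<open>b + s *\<^sub>R p\<close> of radius \<open>s * norm p\<close> lies in
      \<open>ball b \<epsilon>\<close>. Adding 1 covers \<open>p = 0\<close>.\<close>
    define s0 where "s0 = \<epsilon> / (2 * norm p + 1)"
    have s0: "0 < s0" "2 * s0 * norm p < \<epsilon>"
    proof -
      have pos: "2 * norm p + 1 > 0"
        using norm_ge_zero[of p] by linarith
      then show "0 < s0" "2 * s0 * norm p < \<epsilon>"
        using \<epsilon> by (simp_all add: s0_def pos_divide_less_eq algebra_simps)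
    qed
    have nonneg: "0 \<le> par b (s *\<^sub>R \<alpha>) (s *\<^sub>R \<beta>)"
      if "0 \<le> s" "s \<le> 2 ^ j * s0" "norm (b - x) + 2 * s * norm \<alpha> + 2 * s * norm \<beta> \<le> R" for j b s
      using that
    proof (induction j arbitrary: b s)
      case 0
      have sc: "s *\<^sub>R \<alpha> + s *\<^sub>R \<beta> = s *\<^sub>R p" "s *\<^sub>R \<alpha> - s *\<^sub>R \<beta> = s *\<^sub>R q"
        by (simp_all flip: scaleR_add_right scaleR_diff_right add: pq)
      have "0 \<le> 2 * s * norm \<alpha>" "0 \<le> 2 * s * norm \<beta>"
        using 0 by simp_all
      then have "b \<in> cball x R"
        using 0(3) by (simp add: dist_norm norm_minus_commute)
      then obtain z where z: "ball b \<epsilon> \<subseteq> ball z (r z)"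
        using leb by blast
      have "2 * norm (s *\<^sub>R p) < \<epsilon>"
        using 0(1,2) s0(2) mult_right_mono[of s s0 "2 * norm p"] by (simp add: mult_ac)
      then have "cball (b + s *\<^sub>R p) (norm (s *\<^sub>R p)) \<subseteq> ball b \<epsilon>"
        by (subst cball_subset_ball_iff) (simp add: dist_norm)
      then have "bend (b + s *\<^sub>R p) (s *\<^sub>R q) \<le> bend (b + s *\<^sub>R p) (s *\<^sub>R p)"
        using z 0(1) q mult_left_mono[OF q 0(1)] by (intro loc[of _ _ z]) (auto simp: mult_ac)
      then show ?case
        by (simp add: par_def sc add.assoc)
    next
      case (Suc j)
      let ?s = "s / 2"
      have "2 *\<^sub>R ?s *\<^sub>R \<alpha> = s *\<^sub>R \<alpha>" "2 *\<^sub>R ?s *\<^sub>R \<beta> = s *\<^sub>R \<beta>"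
        by simp_all
      then have eq: "par b (s *\<^sub>R \<alpha>) (s *\<^sub>R \<beta>) = par b (?s *\<^sub>R \<alpha>) (?s *\<^sub>R \<beta>)
          + par (b + s *\<^sub>R \<alpha>) (?s *\<^sub>R \<alpha>) (?s *\<^sub>R \<beta>) + par (b + s *\<^sub>R \<beta>) (?s *\<^sub>R \<alpha>) (?s *\<^sub>R \<beta>)
          + par (b + s *\<^sub>R \<alpha> + s *\<^sub>R \<beta>) (?s *\<^sub>R \<alpha>) (?s *\<^sub>R \<beta>)"
        using par_bisect[of b "?s *\<^sub>R \<alpha>" "?s *\<^sub>R \<beta>"] by metis
      have step: "0 \<le> par (b + v) (?s *\<^sub>R \<alpha>) (?s *\<^sub>R \<beta>)" if "norm v \<le> s * norm \<alpha> + s * norm \<beta>" for v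
      proof (rule Suc.IH)
        show "0 \<le> ?s" "?s \<le> 2 ^ j * s0"
          using Suc.prems by auto
        have "norm (b + v - x) \<le> norm (b - x) + norm v"
          using norm_triangle_ineq[of "b - x" v] by (simp add: algebra_simps)
        then show "norm (b + v - x) + 2 * ?s * norm \<alpha> + 2 * ?s * norm \<beta> \<le> R"
          using Suc.prems(3) that by simp
      qed
      have n: "0 \<le> s * norm \<alpha>" "0 \<le> s * norm \<beta>" "norm (s *\<^sub>R \<alpha> + s *\<^sub>R \<beta>) \<le> s * norm \<alpha> + s * norm \<beta>"
        using Suc.prems(1) norm_triangle_ineq[of "s *\<^sub>R \<alpha>" "s *\<^sub>R \<beta>"] by auto
      show ?case
        unfolding eq using step[of 0] step[of "s *\<^sub>R \<alpha>"] step[of "s *\<^sub>R \<beta>"]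
          step[of "s *\<^sub>R \<alpha> + s *\<^sub>R \<beta>"] n Suc.prems(1) by (simp add: add.assoc)
    qed
    obtain j where "1 / s0 < 2 ^ j"
      using real_arch_pow[of 2 "1 / s0"] by auto
    then have "1 \<le> 2 ^ j * s0"
      using s0(1) by (simp add: field_simps)
    then have "0 \<le> par (x - p) \<alpha> \<beta>"
      using nonneg[of 1 j "x - p"] by (simp add: R_def norm_minus_commute)
    then show ?thesis
      by (simp add: par_def pq add.assoc)
  qed
  then show thesis
    using that k by blast
qed

section \<open>Growth of the metric in the whole space\<close>

text \<open>A comparison of distances in arbitrary directions at all scales. Energy bounds
  \<open>norm q * d (x - q) (x + q)\<close> by \<open>bend x (2q)\<close>, hence by
  \<open>bend x p\<close>, hence by \<open>norm p * d (x - p) (x + p)\<close>; the lengths cancel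
  when they are proportional.\<close>

lemma transversal_dist_le:
  obtains \<kappa> B where "0 < \<kappa>" "\<kappa> \<le> 1 / 2" "0 < B"
    "\<And>x p q. norm q \<le> \<kappa> * norm p \<Longrightarrow> d x (x + q) \<le> B * d (x - p) (x + p)"
proof -
  obtain k where k: "0 < k" "k \<le> 1" and bend: "\<And>x p q. norm q \<le> k * norm p \<Longrightarrow> bend x q \<le> bend x p"
    using global_bend_le by blast
  obtain c where c: "0 < c" and low: "\<And>x y. c * norm (x - y) * d x y \<le> energy x y"
    using energy_lower by auto
  define B where "B = 2 / (c * k)"
  have B: "B > 0" using c k by (simp add: B_def)
  have eq: "d (x - q) (x + q) \<le> B * d (x - p) (x + p)" if q: "norm q = k / 2 * norm p" and "p \<noteq> 0" for x p q
  proof -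
    have "c * k * norm p * d (x - q) (x + q) = c * norm ((x - q) - (x + q)) * d (x - q) (x + q)"
    proof -
      have "(x - q) - (x + q) = - (2 *\<^sub>R q)"
        by (simp add: scaleR_2)
      then have "norm ((x - q) - (x + q)) = k * norm p"
        using q by simp
      then show ?thesis by simp
    qed
    also have "\<dots> \<le> energy (x - q) (x + q)"
      by (rule low)
    also have "\<dots> \<le> bend x (2 *\<^sub>R q)"
      using energy_le_bend[of x "2 *\<^sub>R q"] by simp
    also have "\<dots> \<le> bend x p"
      using q by (intro bend) simp
    also have "\<dots> \<le> 2 * norm p * d (x - p) (x + p)"
      by (rule bend_le)
    finally have "norm p * (c * k * d (x - q) (x + q)) \<le> norm p * (2 * d (x - p) (x + p))"
      by (simp add: mult_ac)
    then have "c * k * d (x - q) (x + q) \<le> 2 * d (x - p) (x + p)"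
      using \<open>p \<noteq> 0\<close> by simp
    then show ?thesis
      using c k by (simp add: B_def field_simps)
  qed
  show thesis
  proof (rule that)
    show "0 < k / 2" "k / 2 \<le> 1 / 2" "0 < B"
      using k B by auto
    fix x p q :: "real ^ 'n"
    assume q: "norm q \<le> k / 2 * norm p"
    show "d x (x + q) \<le> B * d (x - p) (x + p)"
    proof (cases "q = 0")
      case True
      then show ?thesis
        using B by (simp add: d_self d_nonneg)
    next
      case False
      \<comment> \<open>A shorter \<open>q\<close> is stretched to the proportional length;
        \<open>d\<close> increases along rays.\<close>
      define s where "s = k / 2 * norm p / norm q"
      have s: "1 \<le> s"
        using q False by (simp add: s_def)
      have "x + q \<in> closed_segment x (x + s *\<^sub>R q)"
        using s by (auto simp: in_segment algebra_simps intro!: exI[of _ "1 / s"])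
      then have "d x (x + q) \<le> d x (x + s *\<^sub>R q)"
        using d_add[of x "x + s *\<^sub>R q" "x + q"] d_nonneg[of "x + q" "x + s *\<^sub>R q"] by simp
      also have "\<dots> \<le> d (x - s *\<^sub>R q) (x + s *\<^sub>R q)"
        using d_add[OF _ _ centre_in_segment, of x "s *\<^sub>R q"] d_nonneg[of "x - s *\<^sub>R q" x] by simp
      also have "\<dots> \<le> B * d (x - p) (x + p)"
      proof (rule eq)
        show "norm (s *\<^sub>R q) = k / 2 * norm p"
          using s False k by (simp add: s_def)
        show "p \<noteq> 0"
          using q False by auto
      qed
      finally show ?thesis .
    qed
  qed
qed

text \<open>A tangential chord of half length of order \<open>\<surd>\<delta> r\<close> inside the ball of radius \<open>r\<close> controls a
  radial segment of comparable length, which sticks out of the ball by \<open>\<delta> r\<close>.\<close>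

lemma ball_expansion:
  assumes "CARD('n) \<ge> 2"
  obtains \<delta> K where "0 < \<delta>" "1 \<le> K"
    "\<And>x r M. 0 \<le> r \<Longrightarrow> \<forall>y\<in>cball x r. d x y \<le> M \<Longrightarrow> \<forall>y\<in>cball x ((1 + \<delta>) * r). d x y \<le> K * M"
proof -
  obtain \<kappa> B where \<kappa>: "0 < \<kappa>" "\<kappa> \<le> 1 / 2" and B: "0 < B"
    and transversal_dist_le: "\<And>x p q. norm q \<le> \<kappa> * norm p \<Longrightarrow> d x (x + q) \<le> B * d (x - p) (x + p)"
    using transversal_dist_le by blast
  \<comment> \<open>The half chord \<open>\<kappa> * r / 2\<close> has length
    \<open>sqrt \<delta> * r\<close>, which fits in the ball at height
    \<open>(1 - \<delta>) * r\<close>, and \<open>\<kappa>\<close> times it is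
    \<open>2 * \<delta> * r\<close>, the distance from there to height
    \<open>(1 + \<delta>) * r\<close>.\<close>
  define \<delta> where "\<delta> = \<kappa>\<^sup>2 / 4"
  have "\<kappa>\<^sup>2 \<le> 1"
    using \<kappa> by (simp add: power_le_one)
  then have \<delta>: "0 < \<delta>" "\<delta> < 1"
    using \<kappa> by (auto simp: \<delta>_def)
  show thesis
  proof (rule that)
    show "0 < \<delta>" "1 \<le> 1 + 2 * B"
      using \<delta> B by auto
    fix x r M assume r: "(0::real) \<le> r" and M: "\<forall>y\<in>cball x r. d x y \<le> M"
    have M0: "0 \<le> M"
      using M[rule_format, of x] r d_nonneg[of x x] by simp
    show "\<forall>y\<in>cball x ((1 + \<delta>) * r). d x y \<le> (1 + 2 * B) * M"
    proof
      fix y assume y: "y \<in> cball x ((1 + \<delta>) * r)"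
      show "d x y \<le> (1 + 2 * B) * M"
      proof (cases "y \<in> cball x r")
        case True
        then have "d x y \<le> 1 * M" using M by auto
        also have "\<dots> \<le> (1 + 2 * B) * M" using M0 B by (intro mult_right_mono) auto
        finally show ?thesis .
      next
        case False
        define \<rho> where "\<rho> = norm (y - x)"
        have \<rho>: "r < \<rho>" "\<rho> \<le> (1 + \<delta>) * r"
          using y False by (auto simp: \<rho>_def dist_norm norm_minus_commute)
        define w where "w = (y - x) /\<^sub>R \<rho>"
        have w: "norm w = 1" "y = x + \<rho> *\<^sub>R w"
          using \<rho> r by (simp_all add: w_def flip: \<rho>_def)
        \<comment> \<open>Dimension at least two provides the tangential direction.\<close>
        obtain v0 where v0: "v0 \<noteq> 0" "orthogonal w v0"
          using orthogonal_to_vector_exists[of w] assms by auto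
        define v where "v = sgn v0"
        have v: "norm v = 1" "w \<bullet> v = 0"
          using v0 by (auto simp: v_def norm_sgn orthogonal_def sgn_div_norm)
        define z where "z = x + ((1 - \<delta>) * r) *\<^sub>R w"
        define p where "p = (\<kappa> / 2 * r) *\<^sub>R v"
        have norm2: "(norm (a *\<^sub>R w + b *\<^sub>R v))\<^sup>2 = a\<^sup>2 + b\<^sup>2" for a b
          unfolding power2_norm_eq_inner
          using v w(1) by (simp add: inner_simps inner_commute[of v w] norm_eq_1 power2_eq_square)
        have inball: "z + e *\<^sub>R p \<in> cball x r" if "e = 1 \<or> e = -1" for e
        proof -
          have "z + e *\<^sub>R p - x = ((1 - \<delta>) * r) *\<^sub>R w + (e * (\<kappa> / 2 * r)) *\<^sub>R v"
            by (simp add: z_def p_def)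
          then have "(norm (z + e *\<^sub>R p - x))\<^sup>2 = ((1 - \<delta>) * r)\<^sup>2 + (e * (\<kappa> / 2 * r))\<^sup>2"
            by (simp only: norm2)
          also have "\<dots> = r\<^sup>2 * (1 - \<delta> + \<delta>\<^sup>2)"
            using that by (auto simp: \<delta>_def power2_eq_square algebra_simps)
          also have "\<dots> \<le> r\<^sup>2 * 1"
            using \<delta> by (intro mult_left_mono) (auto simp: power2_eq_square mult_left_le)
          finally have "norm (z + e *\<^sub>R p - x) \<le> r"
            using r by (simp add: power2_le_iff_abs_le)
          then show ?thesis
            by (simp add: dist_norm norm_minus_commute)
        qed
        have zM: "d x z \<le> M"
        proof -
          have "norm (z - x) \<le> r"
            using w(1) r \<delta> by (simp add: z_def abs_mult mult_left_le_one_le)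
          then show ?thesis
            using M by (auto simp: dist_norm norm_minus_commute)
        qed
        have "norm (y - z) \<le> \<kappa> * norm p"
        proof -
          have "y - z = (\<rho> - (1 - \<delta>) * r) *\<^sub>R w"
            by (simp add: w z_def algebra_simps)
          then have "norm (y - z) = \<rho> - (1 - \<delta>) * r"
            using w(1) \<rho> r \<delta> mult_right_mono[of "1 - \<delta>" 1 r] by simp
          also have "\<dots> \<le> 2 * \<delta> * r"
            using \<rho>(2) by (simp add: algebra_simps)
          also have "\<dots> = \<kappa> * norm p"
            using r \<kappa> v(1) by (simp add: p_def \<delta>_def power2_eq_square)
          finally show ?thesis .
        qed
        then have "d z y \<le> B * d (z - p) (z + p)"
          using transversal_dist_le[of "y - z" p z] by simp
        also have "d (z - p) (z + p) \<le> d x (z - p) + d x (z + p)"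
          using d_triangle[of "z - p" x "z + p"] by (simp add: d_commute[of _ x])
        also have "\<dots> \<le> M + M"
          using M inball[of 1] inball[of "-1"] by (intro add_mono) auto
        finally have "d z y \<le> B * (M + M)"
          using B by simp
        then show ?thesis
          using d_triangle[of x z y] zM by (simp add: algebra_simps)
      qed
    qed
  qed
qed

text \<open>The expansion step is iterated until \<open>(1 + \<delta>) ^ j\<close> exceeds
  \<open>\<Lambda>\<close>.\<close>

lemma doubling:
  assumes "CARD('n) \<ge> 2"
  obtains C where "1 \<le> C"
    "\<And>x r M. 0 \<le> r \<Longrightarrow> \<forall>y\<in>cball x r. d x y \<le> M \<Longrightarrow> \<forall>y\<in>cball x (\<Lambda> * r). d x y \<le> C * M"
proof -
  obtain \<delta> K where \<delta>: "0 < \<delta>" and K: "1 \<le> K"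
    and expand: "\<And>x r M. 0 \<le> r \<Longrightarrow> \<forall>y\<in>cball x r. d x y \<le> M \<Longrightarrow>
      \<forall>y\<in>cball x ((1 + \<delta>) * r). d x y \<le> K * M"
    using ball_expansion[OF assms] by blast
  have iter: "\<forall>y\<in>cball x ((1 + \<delta>) ^ j * r). d x y \<le> K ^ j * M"
    if "0 \<le> r" "\<forall>y\<in>cball x r. d x y \<le> M" for x r M j
  proof (induction j)
    case (Suc j)
    then show ?case
      using expand[of "(1 + \<delta>) ^ j * r" x "K ^ j * M"] that \<delta> by (simp add: mult_ac)
  qed (use that in simp)
  obtain j where j: "\<Lambda> < (1 + \<delta>) ^ j"
    using real_arch_pow[of "1 + \<delta>" \<Lambda>] \<delta> by auto
  show thesis
  proof (rule that[of "K ^ j"])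
    show "1 \<le> K ^ j"
      using K by (rule one_le_power)
    fix x r M assume r: "0 \<le> r" and M: "\<forall>y\<in>cball x r. d x y \<le> M"
    have "cball x (\<Lambda> * r) \<subseteq> cball x ((1 + \<delta>) ^ j * r)"
      using j r by (intro subset_cball mult_right_mono) auto
    then show "\<forall>y\<in>cball x (\<Lambda> * r). d x y \<le> K ^ j * M"
      using iter[OF r M, of j] by blast
  qed
qed

text \<open>Around the midpoint \<open>z\<close> of \<open>[x, y']\<close>, distances on a ball of
  radius proportional to \<open>norm (y' - x)\<close> are bounded by a multiple of
  \<open>d x y'\<close>. Doubling enlarges that ball until it contains both \<open>x\<close> and
  \<open>y\<close>.\<close>

lemma roundness:
  assumes "CARD('n) \<ge> 2"
  obtains A where "1 \<le> A" "\<And>x y y'. norm (y - x) \<le> norm (y' - x) \<Longrightarrow> d x y \<le> A * d x y'"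
proof -
  obtain \<kappa> B where \<kappa>: "0 < \<kappa>" "\<kappa> \<le> 1 / 2" and B: "0 < B"
    and transversal_dist_le: "\<And>x p q. norm q \<le> \<kappa> * norm p \<Longrightarrow> d x (x + q) \<le> B * d (x - p) (x + p)"
    using transversal_dist_le by blast
  \<comment> \<open>The factor \<open>4 / \<kappa>\<close> enlarges radius
    \<open>\<kappa> * norm p\<close> to \<open>4 * norm p\<close>, while \<open>y\<close> is within
    \<open>3 * norm p\<close> of the midpoint.\<close>
  obtain C where C: "1 \<le> C" and doubling: "\<And>x r M. 0 \<le> r \<Longrightarrow> \<forall>y\<in>cball x r. d x y \<le> M \<Longrightarrow>
      \<forall>y\<in>cball x (4 / \<kappa> * r). d x y \<le> C * M"
    using doubling[OF assms] by blast
  have main: "d x y \<le> 2 * C * B * d x y'" if le: "norm (y - x) \<le> norm (y' - x)" for x y y'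
  proof -
    define p where "p = (y' - x) /\<^sub>R 2"
    define z where "z = x + p"
    have p: "norm p = norm (y' - x) / 2"
      by (simp add: p_def)
    have "p + p = y' - x"
      by (simp add: p_def flip: scaleR_2)
    then have zp: "z - p = x" "z + p = y'"
      by (simp_all add: z_def add.assoc)
    have "\<forall>w\<in>cball z (\<kappa> * norm p). d z w \<le> B * d x y'"
    proof
      fix w assume "w \<in> cball z (\<kappa> * norm p)"
      then show "d z w \<le> B * d x y'"
        using transversal_dist_le[of "w - z" p z] zp by (simp add: dist_norm norm_minus_commute)
    qed
    then have ball: "\<forall>w\<in>cball z (4 / \<kappa> * (\<kappa> * norm p)). d z w \<le> C * (B * d x y')"
      using \<kappa> by (intro doubling) auto
    have "norm (y - z) \<le> norm (y - x) + norm p"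
      using norm_triangle_ineq4[of "y - x" p] by (simp add: z_def algebra_simps)
    then have "norm (y - z) \<le> 4 * norm p" "norm (x - z) \<le> 4 * norm p"
      using le p norm_ge_zero[of p] by (simp_all add: z_def del: norm_ge_zero)
    then have "d z x \<le> C * (B * d x y')" "d z y \<le> C * (B * d x y')"
      using ball \<kappa> by (auto simp: dist_norm norm_minus_commute)
    then show ?thesis
      using d_triangle[of x z y] by (simp add: d_commute[of x z] algebra_simps)
  qed
  show thesis
  proof (rule that[of "max 1 (2 * C * B)"])
    fix x y y' :: "real ^ 'n" assume "norm (y - x) \<le> norm (y' - x)"
    then have "d x y \<le> 2 * C * B * d x y'"
      by (rule main)
    also have "\<dots> \<le> max 1 (2 * C * B) * d x y'"
      by (intro mult_right_mono d_nonneg) simp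
    finally show "d x y \<le> max 1 (2 * C * B) * d x y'" .
  qed simp
qed

text \<open>Additivity on \<open>[0, 2v]\<close> and roundness at \<open>v\<close> give geometric
  growth along one ray; roundness at 0 spreads it to all directions.\<close>

lemma d_unbounded:
  assumes "CARD('n) \<ge> 2"
  obtains R where "\<And>x. R \<le> norm x \<Longrightarrow> M < d 0 x"
proof -
  obtain A where A: "1 \<le> A"
    and round: "\<And>x y y'. norm (y - x) \<le> norm (y' - x) \<Longrightarrow> d x y \<le> A * d x y'"
    using roundness[OF assms] by blast
  have double: "(1 + 1 / A) * d 0 v \<le> d 0 (2 *\<^sub>R v)" for v
  proof -
    have "v \<in> closed_segment 0 (2 *\<^sub>R v)"
      by (auto simp: in_segment intro!: exI[of _ "1 / 2"])
    then have "d 0 (2 *\<^sub>R v) = d 0 v + d v (2 *\<^sub>R v)"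
      by (intro d_add) auto
    moreover have "norm (0 - v) \<le> norm (2 *\<^sub>R v - v)"
      by (simp add: scaleR_2)
    then have "d v 0 \<le> A * d v (2 *\<^sub>R v)"
      by (rule round)
    ultimately show ?thesis
      using A by (simp add: d_commute[of v] field_simps)
  qed
  have pow: "(1 + 1 / A) ^ j * d 0 v \<le> d 0 (2 ^ j *\<^sub>R v)" for j v
  proof (induction j)
    case (Suc j)
    have "(1 + 1 / A) ^ Suc j * d 0 v = (1 + 1 / A) * ((1 + 1 / A) ^ j * d 0 v)"
      by simp
    also have "\<dots> \<le> (1 + 1 / A) * d 0 (2 ^ j *\<^sub>R v)"
      using A Suc by (intro mult_left_mono) auto
    also have "\<dots> \<le> d 0 (2 ^ Suc j *\<^sub>R v)"
      using double[of "2 ^ j *\<^sub>R v"] by simp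
    finally show ?case .
  qed simp
  define v :: "real ^ 'n" where "v = axis undefined 1"
  have v: "norm v = 1"
    by (simp add: v_def)
  then have pos: "0 < d 0 v"
    by (intro d_pos) auto
  obtain j where j: "A * M / d 0 v < (1 + 1 / A) ^ j"
    using real_arch_pow[of "1 + 1 / A"] A by auto
  show thesis
  proof (rule that)
    fix x :: "real ^ 'n" assume x: "2 ^ j \<le> norm x"
    have "A * M < (1 + 1 / A) ^ j * d 0 v"
      using j pos by (simp add: field_simps)
    also have "\<dots> \<le> d 0 (2 ^ j *\<^sub>R v)"
      by (rule pow)
    also have "\<dots> \<le> A * d 0 x"
      using x v by (intro round) simp
    finally show "M < d 0 x"
      using A by simp
  qed
qed

section \<open>Surjectivity in the whole space\<close>

text \<open>The range is open and, by growth of \<open>d\<close>, closed: preimages of a bounded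
  sequence stay in a compact ball. Connectedness of the space finishes the argument.\<close>

lemma surj_monotone_map:
  assumes "CARD('n) \<ge> 2"
  shows "range (monotone_map 0) = UNIV"
proof -
  let ?F = "monotone_map 0"
  obtain c where c: "0 < c" and low: "\<And>x y. c * d x y \<le> norm (?F x - ?F y)"
    using monotone_map_lower by (metis UNIV_I)
  have "closed (range ?F)"
    unfolding closed_sequential_limits
  proof (intro allI impI, elim conjE)
    fix f l assume f: "\<forall>k. f k \<in> range ?F" and l: "f \<longlonglongrightarrow> l"
    then obtain M where M: "\<And>k. norm (f k) \<le> M"
      using convergent_imp_Bseq[of f] by (auto simp: convergent_def Bseq_def)
    obtain R where R: "\<And>x. R \<le> norm x \<Longrightarrow> (M + norm (?F 0)) / c < d 0 x"
      using d_unbounded[OF assms] by blast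
    have "f k \<in> ?F ` cball 0 R" for k
    proof -
      obtain x where x: "f k = ?F x"
        using f by blast
      have "c * d 0 x \<le> norm (?F 0 - ?F x)"
        by (rule low)
      also have "\<dots> \<le> norm (?F 0) + norm (?F x)"
        by (rule norm_triangle_ineq4)
      also have "\<dots> \<le> M + norm (?F 0)"
        using M[of k] x by simp
      finally have "d 0 x \<le> (M + norm (?F 0)) / c"
        using c by (simp add: field_simps)
      then have "norm x \<le> R"
        using R[of x] by linarith
      then show ?thesis
        using x by auto
    qed
    moreover have "compact (?F ` cball 0 R)"
      by (intro compact_continuous_image compact_cball continuous_on_subset[OF continuous_on_monotone_map]) auto
    ultimately have "l \<in> ?F ` cball 0 R"
      using l closed_sequentially compact_imp_closed by metis
    then show "l \<in> range ?F"
      by blast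
  qed
  moreover have "open (range ?F)" "range ?F \<noteq> {}"
    using monotone_map_image(1)[of 0] by (auto simp: is_domain_def)
  ultimately show ?thesis
    using clopen[of "range ?F"] by blast
qed

lemma bilipschitz_equivalent_UNIV:
  assumes "CARD('n) \<ge> 2"
  shows "bilipschitz_equivalent UNIV d (UNIV :: (real ^ 'n) set) dist"
  using monotone_map_image(2)[of 0] surj_monotone_map[OF assms] by simp

end

theorem theorem1p2:
  fixes \<Omega> :: "(real ^ 'n) set"
    and \<nu> :: "(real ^ 'n) set measure"
  assumes "CARD('n) \<ge> 2"
    and "is_domain \<Omega>" and "convex \<Omega>"
    and "admissible \<Omega> \<nu>"
    and "\<exists>\<eta>. qs_modulus \<eta> \<and> locally_quasisymmetric \<eta> \<Omega> (busemann_dist \<nu>) id"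
  shows "(\<exists>\<Omega>' :: (real ^ 'n) set.
            is_domain \<Omega>' \<and> bilipschitz_equivalent \<Omega> (busemann_dist \<nu>) \<Omega>' dist) \<and>
         (\<Omega> = UNIV \<longrightarrow>
            bilipschitz_equivalent \<Omega> (busemann_dist \<nu>) (UNIV :: (real ^ 'n) set) dist)"
proof -
  interpret admissible_measure \<Omega> \<nu>
    using assms by unfold_locales (auto simp: is_domain_def)
  interpret comparable_measure \<Omega> \<nu>
    using assms(5) locally_quasisymmetric_comparable by unfold_locales blast
  obtain p where p: "p \<in> \<Omega>"
    using assms(2) by (auto simp: is_domain_def)
  have "bilipschitz_equivalent \<Omega> d (UNIV :: (real ^ 'n) set) dist" if "\<Omega> = UNIV"
    using comparable_measure_axioms global_comparable_measure.bilipschitz_equivalent_UNIV[of \<nu>]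
      assms(1) that by (simp add: global_comparable_measure_def)
  then show ?thesis
    using monotone_map_image[OF p] by blast
qed

end
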